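(* Let $p\geq 2$ be an integer, $\ell_0\in\mathbb{C}$ and $\underline{\ell}=(\ell_0,0,\ldots,0)\in\mathbb{C}^{[\frac p2]+1}$. Let $W$ be a $\sigma_p$-twisted $V_{\mathcal{N}_p}(\underline{\ell},0)$-module with twisted vertex operator map $Y_W$. Then $W$ is a restricted $\mathfrak{g}_p$-module of level $\underline{\ell}$ with $$L(x)=Y_W(T_{-2}\mathbf{1},x),\qquad I^i_p(x)=Y_W(N^i_{-1}\mathbf{1},x),\quad i=1,\ldots,p-1,$$ where $L(x)=\sum_{n\in\mathbb{Z}}L(n)x^{-n-2}$ and $I^i_p(x)=\sum_{n\in\mathbb{Z}}I^i(n)x^{-n-\frac ip-1}$.
   Context: Let $[\frac p2]$ be the largest integer not exceeding $\frac p2$. Gap-$p$ Virasoro algebra: $\mathfrak{g}_p$ is the complex Lie algebra with basis $L(m)$, $I^i(m)$, $\overline{C}_j$ ($m\in\mathbb{Z}$, $1\le i\le p-1$, $0\le j\le[\frac p2]$), with $\overline{C}_j$ central and $$[L(m),L(n)]=(m-n)L(m+n)+\tfrac{1}{12}(m^3-m)\delta_{m+n,0}\overline{C}_0,$$ $$[L(m),I^i(n)]=-(n+\tfrac ip)I^i(m+n),\qquad [I^i(m),I^j(n)]=(m+\tfrac ip)\delta_{i+j,p}\delta_{m+n+1,0}\overline{C}_i,$$ where $\overline{C}_i:=\overline{C}_{p-i}$ for $i>[\frac p2]$. A $\mathfrak{g}_p$-module $W$ is restricted if for every $w\in W$, $L(n)w=I^i(n)w=0$ for all sufficiently large $n$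 and $i=1,\ldots,p-1$. It is of level $\underline{\ell}=(\ell_0,\ldots,\ell_{[\frac p2]})$ if $\overline{C}_i$ acts as the scalar $\ell_i$ for $0\le i\le[\frac p2]$. The Lie algebra $\mathcal{N}_p$ has basis $T_m$, $N^i_m$ ($m\in\mathbb{Z}$, $1\le i\le p-1$) and central elements $K_0,\ldots,K_{[\frac p2]}$, with $$[T_m,T_n]=(m-n)T_{m+n}+\tfrac1{12}(m^3-m)\delta_{m+n,0}K_0,$$ $$[T_m,N^i_n]=-nN^i_{m+n},\qquad [N^i_m,N^j_n]=m\delta_{i+j,p}\delta_{m+n,0}K_i,$$ where $K_i:=K_{p-i}$ for $i>[\frac p2]$. Let $(\mathcal{N}_p)_{(\le 1)}$ be the subalgebra spanned by $T_m$ ($m\ge -1$), $N^i_n$ ($n\ge 0$, $1\le i\le p-1$) and all $K_j$. It acts on $\mathbb{C}$ with these $T_m$, $N^i_n$ acting as $0$ and $K_j$ as $\ell_j$. Set $V_{\mathcal{N}_p}(\underline{\ell},0)=\mathcal{U}(\mathcal{N}_p)\otimes_{\mathcal{U}((\mathcal{N}_p)_{(\le1)})}\mathbb{C}$, where $\mathcal{U}$ denotes the universal enveloping algebra, and $\mathbf{1}=1\otimes1$. It is a vertex operator algebra with vacuum $\mathbf 1$ and conformal vector $\omega=T_{-2}\mathbf 1$, generated by $T_{-2}\mathbf 1$ and $N^i_{-1}\mathbf 1$ ($1\le i\le p-1$), with $Y(T_{-2}\mathbf 1,x)=\sum_n T_nx^{-n-2}$, $Y(N^i_{-1}\mathbf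 1,x)=\sum_n N^i_nx^{-n-1}$. Let $\xi_p$ be a primitive $p$-th root of unity, and let $\sigma_p:\mathcal{N}_p\to\mathcal{N}_p$ be the linear map $$\sigma_p(T_m)=T_m,\quad \sigma_p(N^i_m)=\xi_pN^i_m,\quad \sigma_p(K_0)=K_0,\quad \sigma_p(K_i)=\xi_p^2K_i\qquad(m\in\mathbb{Z},\ i=1,\ldots,p-1),$$ an automorphism of the Lie algebra $\mathcal{N}_p$ of order $p$. For $\underline{\ell}=(\ell_0,0,\ldots,0)$ it lifts naturally to an automorphism of the vertex (operator) algebra $V_{\mathcal{N}_p}(\underline{\ell},0)$, again denoted $\sigma_p$. Twisted modules are understood in the usual sense: for a vertex algebra $V$ with automorphism $\sigma$, $\sigma^p=1$, put $V^r=\{v\in V:\sigma v=\xi_p^rv\}$. A $\sigma$-twisted $V$-module is a vector space $W$ with a linear map $Y_W(\cdot,x):V\to(\mathrm{End}\,W)[[x^{1/p},x^{-1/p}]]$ such that $Y_W(\mathbf 1,x)=\mathrm{id}_W$; for $v\in V^r$ and $w\in W$, $x^{r/p}Y_W(v,x)w\in W((x))$; and for $u\in V^r$, $v\in V$, $$x_0^{-1}\delta\Big(\frac{x_1-x_2}{x_0}\Big)Y_W(u,x_1)Y_W(v,x_2)-x_0^{-1}\delta\Big(\frac{x_2-x_1}{-x_0}\Big)Y_W(v,x_2)Y_W(u,x_1)$$ $$=x_2^{-1}\Big(\frac{x_1-x_0}{x_2}\Big)^{-r/p}\delta\Big(\frac{x_1-x_0}{x_2}\Big)Y_W(Y(u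,x_0)v,x_2).$$
   Formalization: The automorphism is taken as σ_p(N^i_m)=ξ_p^i N^i_m, σ_p(K_i)=K_i instead of the printed ξ_p N^i_m, ξ_p^2 K_i; with the printed map the claim fails for p≥3, since Y_W(N^i_{-1}1,x) would have exponents in -1/p+Z rather than -i/p+Z. *)

theory Defs
  imports Complex_Main "HOL-Library.Poly_Mapping" "HOL-Algebra.Module"
begin

section \<open>Complex Lie algebras given by a basis\<close>

text \<open>
  A Lie algebra with a distinguished basis is given by the set \<open>B\<close> of basis symbols and by the
  brackets \<open>br a b\<close> of basis elements. Its elements are the finitely supported coefficient
  functions whose support lies in \<open>B\<close>.
\<close>

definition pscale :: "complex \<Rightarrow> ('a \<Rightarrow>\<^sub>0 complex) \<Rightarrow> ('a \<Rightarrow>\<^sub>0 complex)" where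
  "pscale c f = Poly_Mapping.map ((*) c) f"

definition lie_carrier :: "'g set \<Rightarrow> ('g \<Rightarrow>\<^sub>0 complex) set" where
  "lie_carrier B = {x. Poly_Mapping.keys x \<subseteq> B}"

definition bas :: "'g \<Rightarrow> ('g \<Rightarrow>\<^sub>0 complex)" where
  "bas g = Poly_Mapping.single g 1"

definition lie_bracket ::
  "('g \<Rightarrow> 'g \<Rightarrow> ('g \<Rightarrow>\<^sub>0 complex)) \<Rightarrow> ('g \<Rightarrow>\<^sub>0 complex) \<Rightarrow> ('g \<Rightarrow>\<^sub>0 complex) \<Rightarrow> ('g \<Rightarrow>\<^sub>0 complex)" where
  "lie_bracket br x y =
     (\<Sum>a\<in>Poly_Mapping.keys x. \<Sum>b\<in>Poly_Mapping.keys y.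
        pscale (Poly_Mapping.lookup x a * Poly_Mapping.lookup y b) (br a b))"

definition lie_module ::
  "'g set \<Rightarrow> ('g \<Rightarrow> 'g \<Rightarrow> ('g \<Rightarrow>\<^sub>0 complex)) \<Rightarrow> (complex \<Rightarrow> 'w::ab_group_add \<Rightarrow> 'w) \<Rightarrow>
    (('g \<Rightarrow>\<^sub>0 complex) \<Rightarrow> 'w \<Rightarrow> 'w) \<Rightarrow> bool" where
  "lie_module B br sc \<rho> \<longleftrightarrow>
     vector_space sc \<and>
     (\<forall>x\<in>lie_carrier B. Vector_Spaces.linear sc sc (\<rho> x)) \<and>
     (\<forall>x\<in>lie_carrier B. \<forall>y\<in>lie_carrier B. \<forall>w. \<rho> (x + y) w = \<rho> x w + \<rho> y w) \<and>
     (\<forall>c. \<forall>x\<in>lie_carrier B. \<forall>w. \<rho> (pscale c x) w = sc c (\<rho> x w)) \<and>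
     (\<forall>x\<in>lie_carrier B. \<forall>y\<in>lie_carrier B. \<forall>w.
        \<rho> (lie_bracket br x y) w = \<rho> x (\<rho> y w) - \<rho> y (\<rho> x w))"


section \<open>Enveloping algebras and induced modules\<close>

datatype 'g fword = FWord (letters: "'g list")

instantiation fword :: (type) monoid_add
begin
definition "0 = FWord []"
definition "u + v = FWord (letters u @ letters v)"
instance
  by standard (simp_all add: zero_fword_def plus_fword_def)
end

text \<open>
  The free associative algebra on \<open>B\<close>, i.e. the tensor algebra of the space with basis \<open>B\<close>; its
  product is the convolution product of \<open>poly_mapping\<close> for concatenation of words.
\<close>

definition free_alg :: "'g set \<Rightarrow> ('g fword \<Rightarrow>\<^sub>0 complex) set" where
  "free_alg B = {f. \<forall>u\<in>Poly_Mapping.keys f. set (letters u) \<subseteq> B}"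

definition scalar :: "complex \<Rightarrow> ('g fword \<Rightarrow>\<^sub>0 complex)" where
  "scalar c = Poly_Mapping.single 0 c"

definition iota :: "('g \<Rightarrow>\<^sub>0 complex) \<Rightarrow> ('g fword \<Rightarrow>\<^sub>0 complex)" where
  "iota x = (\<Sum>g\<in>Poly_Mapping.keys x. Poly_Mapping.single (FWord [g]) (Poly_Mapping.lookup x g))"

definition uea_rel ::
  "'g set \<Rightarrow> ('g \<Rightarrow> 'g \<Rightarrow> ('g \<Rightarrow>\<^sub>0 complex)) \<Rightarrow> ('g fword \<Rightarrow>\<^sub>0 complex) set" where
  "uea_rel B br =
     {a * (iota x * iota y - iota y * iota x - iota (lie_bracket br x y)) * b | a b x y.
        a \<in> free_alg B \<and> b \<in> free_alg B \<and> x \<in> lie_carrier B \<and> y \<in> lie_carrier B}"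

text \<open>The algebra homomorphism from the free algebra to \<open>\<complex>\<close> with \<open>g \<mapsto> \<chi> g\<close> on generators.\<close>

definition char_ext :: "('g \<Rightarrow> complex) \<Rightarrow> ('g fword \<Rightarrow>\<^sub>0 complex) \<Rightarrow> complex" where
  "char_ext \<chi> f =
     (\<Sum>u\<in>Poly_Mapping.keys f. Poly_Mapping.lookup f u * prod_list (map \<chi> (letters u)))"

text \<open>
  Let \<open>S \<subseteq> B\<close> span a subalgebra \<open>\<bb>\<close> of the Lie algebra \<open>\<gg>\<close>, acting on \<open>\<complex>\<close> through the
  character \<open>\<chi>\<close>. Identifying \<open>u \<otimes> z\<close> with \<open>z u\<close>, the space \<open>\<U>(\<gg>) \<otimes> \<complex>\<close>, tensor product over
  \<open>\<U>(\<bb>)\<close>, is the quotient of \<open>\<U>(\<gg>)\<close> by the balancing relations \<open>u b \<otimes> 1 = u \<otimes> b 1\<close>, hence the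
  quotient of the free algebra by those relations together with the defining relations of
  \<open>\<U>(\<gg>)\<close>.
\<close>

definition ind_rel ::
  "'g set \<Rightarrow> ('g \<Rightarrow> 'g \<Rightarrow> ('g \<Rightarrow>\<^sub>0 complex)) \<Rightarrow> 'g set \<Rightarrow> ('g \<Rightarrow> complex) \<Rightarrow>
    ('g fword \<Rightarrow>\<^sub>0 complex) set" where
  "ind_rel B br S \<chi> =
     module.span pscale
       (uea_rel B br \<union>
        {a * b - pscale (char_ext \<chi> b) a | a b. a \<in> free_alg B \<and> b \<in> free_alg S})"

definition cls :: "'f::plus set \<Rightarrow> 'f \<Rightarrow> 'f set" where
  "cls R a = {a + r | r. r \<in> R}"

text \<open>
  A quotient of a subspace \<open>A\<close> of the free algebra by \<open>R\<close>, as a module record; the ring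
  multiplication of the record type plays no role.
\<close>

definition quotient_space ::
  "('a \<Rightarrow>\<^sub>0 complex) set \<Rightarrow> ('a \<Rightarrow>\<^sub>0 complex) set \<Rightarrow> (complex, ('a \<Rightarrow>\<^sub>0 complex) set) module" where
  "quotient_space A R =
     \<lparr>carrier = cls R ` A, mult = undefined, one = undefined, zero = R,
      add = (\<lambda>X Y. {x + y | x y. x \<in> X \<and> y \<in> Y}),
      smult = (\<lambda>c X. {pscale c x + r | x r. x \<in> X \<and> r \<in> R})\<rparr>"

definition ind_module ::
  "'g set \<Rightarrow> ('g \<Rightarrow> 'g \<Rightarrow> ('g \<Rightarrow>\<^sub>0 complex)) \<Rightarrow> 'g set \<Rightarrow> ('g \<Rightarrow> complex) \<Rightarrow>
    (complex, ('g fword \<Rightarrow>\<^sub>0 complex) set) module" where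
  "ind_module B br S \<chi> = quotient_space (free_alg B) (ind_rel B br S \<chi>)"

definition ind_act ::
  "'g set \<Rightarrow> ('g \<Rightarrow> 'g \<Rightarrow> ('g \<Rightarrow>\<^sub>0 complex)) \<Rightarrow> 'g set \<Rightarrow> ('g \<Rightarrow> complex) \<Rightarrow>
    ('g \<Rightarrow>\<^sub>0 complex) \<Rightarrow> ('g fword \<Rightarrow>\<^sub>0 complex) set \<Rightarrow> ('g fword \<Rightarrow>\<^sub>0 complex) set" where
  "ind_act B br S \<chi> x X = {iota x * y + r | y r. y \<in> X \<and> r \<in> ind_rel B br S \<chi>}"


section \<open>Vertex algebras and twisted modules\<close>

definition complex_ring :: "complex ring" where
  "complex_ring = \<lparr>carrier = UNIV, mult = (*), one = 1, zero = 0, add = (+)\<rparr>"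

text \<open>
  \<open>Y u m v\<close> is the coefficient of \<open>x\<^sup>m\<close> in \<open>Y(u,x)v\<close>. The Jacobi identity is stated for the
  coefficient of \<open>x\<^sub>0\<^sup>a x\<^sub>1\<^sup>b x\<^sub>2\<^sup>c\<close>, after inserting
  \<open>x\<^sub>0\<^sup>-\<^sup>1 \<delta>((x\<^sub>1-x\<^sub>2)/x\<^sub>0) = \<Sum>n\<in>\<int>. x\<^sub>0\<^sup>-\<^sup>n\<^sup>-\<^sup>1 (x\<^sub>1-x\<^sub>2)\<^sup>n\<close> and so on, where binomials are expanded in
  nonnegative powers of the second variable; only \<open>n = -a-1\<close> contributes to the two terms on the
  left. All sums are finite by truncation.
\<close>

definition vertex_algebra ::
  "(complex, 'v) module \<Rightarrow> 'v \<Rightarrow> ('v \<Rightarrow> int \<Rightarrow> 'v \<Rightarrow> 'v) \<Rightarrow> bool" where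
  "vertex_algebra V vac Y \<longleftrightarrow>
     Module.module complex_ring V \<and> vac \<in> carrier V \<and>
     (\<forall>u\<in>carrier V. \<forall>v\<in>carrier V. \<forall>m. Y u m v \<in> carrier V) \<and>
     (\<forall>u\<in>carrier V. \<forall>u'\<in>carrier V. \<forall>v\<in>carrier V. \<forall>m.
        Y (u \<oplus>\<^bsub>V\<^esub> u') m v = Y u m v \<oplus>\<^bsub>V\<^esub> Y u' m v \<and>
        Y v m (u \<oplus>\<^bsub>V\<^esub> u') = Y v m u \<oplus>\<^bsub>V\<^esub> Y v m u') \<and>
     (\<forall>c. \<forall>u\<in>carrier V. \<forall>v\<in>carrier V. \<forall>m.
        Y (c \<odot>\<^bsub>V\<^esub> u) m v = c \<odot>\<^bsub>V\<^esub> Y u m v \<and> Y u m (c \<odot>\<^bsub>V\<^esub> v) = c \<odot>\<^bsub>V\<^esub> Y u m v) \<and>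
     (\<forall>u\<in>carrier V. \<forall>v\<in>carrier V. \<exists>N. \<forall>m<N. Y u m v = \<zero>\<^bsub>V\<^esub>) \<and>
     (\<forall>v\<in>carrier V. \<forall>m. Y vac m v = (if m = 0 then v else \<zero>\<^bsub>V\<^esub>)) \<and>
     (\<forall>v\<in>carrier V. Y v 0 vac = v \<and> (\<forall>m<0. Y v m vac = \<zero>\<^bsub>V\<^esub>)) \<and>
     (\<forall>u\<in>carrier V. \<forall>v\<in>carrier V. \<forall>w\<in>carrier V. \<forall>a b c.
        (let n = - a - 1;
             F = (\<lambda>k::nat. ((-1) ^ k * (of_int n gchoose k)) \<odot>\<^bsub>V\<^esub>
                    Y u (b - n + int k) (Y v (c - int k) w));
             G = (\<lambda>k::nat. ((-1) powi n * (-1) ^ k * (of_int n gchoose k)) \<odot>\<^bsub>V\<^esub>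
                    Y v (c - n + int k) (Y u (b - int k) w));
             H = (\<lambda>k::nat. ((-1) ^ k * (of_int (b + int k) gchoose k)) \<odot>\<^bsub>V\<^esub>
                    Y (Y u (a - int k) v) (c + b + int k + 1) w)
         in (\<Oplus>\<^bsub>V\<^esub>k\<in>{k. F k \<noteq> \<zero>\<^bsub>V\<^esub>}. F k) \<ominus>\<^bsub>V\<^esub> (\<Oplus>\<^bsub>V\<^esub>k\<in>{k. G k \<noteq> \<zero>\<^bsub>V\<^esub>}. G k) =
            (\<Oplus>\<^bsub>V\<^esub>k\<in>{k. H k \<noteq> \<zero>\<^bsub>V\<^esub>}. H k)))"

definition eigenspace ::
  "(complex, 'v) module \<Rightarrow> ('v \<Rightarrow> 'v) \<Rightarrow> complex \<Rightarrow> nat \<Rightarrow> 'v set" where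
  "eigenspace V \<sigma> \<xi> r = {v \<in> carrier V. \<sigma> v = (\<xi> ^ r) \<odot>\<^bsub>V\<^esub> v}"

text \<open>
  \<open>YW v k w\<close> is the coefficient of \<open>x\<^sup>k\<^sup>/\<^sup>p\<close> in \<open>Y\<^sub>W(v,x)w\<close>. The Jacobi identity is stated for the
  coefficient of \<open>x\<^sub>0\<^sup>a x\<^sub>1\<^sup>b\<^sup>/\<^sup>p x\<^sub>2\<^sup>c\<^sup>/\<^sup>p\<close>. On its right-hand side, the kernel is
  \<open>\<Sum>n\<in>\<int>. x\<^sub>2\<^sup>-\<^sup>1 ((x\<^sub>1-x\<^sub>0)/x\<^sub>2)\<^sup>n\<^sup>-\<^sup>r\<^sup>/\<^sup>p\<close>, so the power of \<open>x\<^sub>1\<close> is \<open>b/p = n - r/p - k\<close> for the \<open>k\<close>-th term of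
  the binomial expansion in \<open>x\<^sub>0\<close>; this requires \<open>p\<close> to divide \<open>b + r\<close>.
\<close>

definition twisted_module ::
  "(complex, 'v) module \<Rightarrow> 'v \<Rightarrow> ('v \<Rightarrow> int \<Rightarrow> 'v \<Rightarrow> 'v) \<Rightarrow> ('v \<Rightarrow> 'v) \<Rightarrow> nat \<Rightarrow> complex \<Rightarrow>
    (complex \<Rightarrow> 'w::ab_group_add \<Rightarrow> 'w) \<Rightarrow> ('v \<Rightarrow> int \<Rightarrow> 'w \<Rightarrow> 'w) \<Rightarrow> bool" where
  "twisted_module V vac Y \<sigma> p \<xi> sc YW \<longleftrightarrow>
     vector_space sc \<and>
     (\<forall>v\<in>carrier V. \<forall>k. Vector_Spaces.linear sc sc (YW v k)) \<and>
     (\<forall>u\<in>carrier V. \<forall>v\<in>carrier V. \<forall>k w. YW (u \<oplus>\<^bsub>V\<^esub> v) k w = YW u k w + YW v k w) \<and>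
     (\<forall>c. \<forall>v\<in>carrier V. \<forall>k w. YW (c \<odot>\<^bsub>V\<^esub> v) k w = sc c (YW v k w)) \<and>
     (\<forall>k w. YW vac k w = (if k = 0 then w else 0)) \<and>
     (\<forall>r<p. \<forall>v\<in>eigenspace V \<sigma> \<xi> r. \<forall>w.
        (\<forall>k. \<not> int p dvd k + int r \<longrightarrow> YW v k w = 0) \<and> (\<exists>N. \<forall>k<N. YW v k w = 0)) \<and>
     (\<forall>r<p. \<forall>u\<in>eigenspace V \<sigma> \<xi> r. \<forall>v\<in>carrier V. \<forall>w. \<forall>a b c.
        (let n = - a - 1;
             F = (\<lambda>k::nat. sc ((-1) ^ k * (of_int n gchoose k))
                    (YW u (b - int p * n + int p * int k) (YW v (c - int p * int k) w)));
             G = (\<lambda>k::nat. sc ((-1) powi n * (-1) ^ k * (of_int n gchoose k))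
                    (YW v (c - int p * n + int p * int k) (YW u (b - int p * int k) w)));
             H = (\<lambda>k::nat. sc ((-1) ^ k * ((of_int b / of_nat p + of_nat k) gchoose k))
                    (YW (Y u (a - int k) v) (c + b + int p * int k + int p) w))
         in Sum_any F - Sum_any G = (if int p dvd b + int r then Sum_any H else 0)))"


section \<open>The gap-\<open>p\<close> Virasoro algebra\<close>

definition fold_index :: "nat \<Rightarrow> nat \<Rightarrow> nat" where
  "fold_index p i = (if i > p div 2 then p - i else i)"

datatype gap_gen = L int | I nat int | C nat

definition gap_basis :: "nat \<Rightarrow> gap_gen set" where
  "gap_basis p =
     {L m | m. True} \<union> {I i m | i m. 1 \<le> i \<and> i \<le> p - 1} \<union> {C j | j. j \<le> p div 2}"

fun gap_br :: "nat \<Rightarrow> gap_gen \<Rightarrow> gap_gen \<Rightarrow> (gap_gen \<Rightarrow>\<^sub>0 complex)" where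
  "gap_br p (L m) (L n) =
     pscale (of_int (m - n)) (bas (L (m + n))) +
     (if m + n = 0 then pscale (of_int (m ^ 3 - m) / 12) (bas (C 0)) else 0)"
| "gap_br p (L m) (I i n) = pscale (- (of_int n + of_nat i / of_nat p)) (bas (I i (m + n)))"
| "gap_br p (I i n) (L m) = pscale (of_int n + of_nat i / of_nat p) (bas (I i (m + n)))"
| "gap_br p (I i m) (I j n) =
     (if i + j = p \<and> m + n + 1 = 0
      then pscale (of_int m + of_nat i / of_nat p) (bas (C (fold_index p i))) else 0)"
| "gap_br p (C j) _ = 0"
| "gap_br p _ (C j) = 0"

definition gap_module ::
  "nat \<Rightarrow> (complex \<Rightarrow> 'w::ab_group_add \<Rightarrow> 'w) \<Rightarrow> ((gap_gen \<Rightarrow>\<^sub>0 complex) \<Rightarrow> 'w \<Rightarrow> 'w) \<Rightarrow> bool" where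
  "gap_module p = lie_module (gap_basis p) (gap_br p)"

definition restricted :: "nat \<Rightarrow> ((gap_gen \<Rightarrow>\<^sub>0 complex) \<Rightarrow> 'w::zero \<Rightarrow> 'w) \<Rightarrow> bool" where
  "restricted p \<rho> \<longleftrightarrow>
     (\<forall>w. \<exists>N. \<forall>n\<ge>N. \<rho> (bas (L n)) w = 0 \<and> (\<forall>i\<in>{1..p-1}. \<rho> (bas (I i n)) w = 0))"

definition has_level ::
  "nat \<Rightarrow> (complex \<Rightarrow> 'w \<Rightarrow> 'w) \<Rightarrow> ((gap_gen \<Rightarrow>\<^sub>0 complex) \<Rightarrow> 'w \<Rightarrow> 'w) \<Rightarrow> (nat \<Rightarrow> complex) \<Rightarrow> bool" where
  "has_level p sc \<rho> l \<longleftrightarrow> (\<forall>j\<le>p div 2. \<forall>w. \<rho> (bas (C j)) w = sc (l j) w)"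

text \<open>
  The series \<open>\<Sum>n. L(n) x\<^sup>-\<^sup>n\<^sup>-\<^sup>2\<close> and \<open>\<Sum>n. I\<^sup>i(n) x\<^sup>-\<^sup>n\<^sup>-\<^sup>i\<^sup>/\<^sup>p\<^sup>-\<^sup>1\<close>, as families of coefficients of
  \<open>x\<^sup>k\<^sup>/\<^sup>p\<close>, \<open>k \<in> \<int>\<close>.
\<close>

definition L_series ::
  "nat \<Rightarrow> ((gap_gen \<Rightarrow>\<^sub>0 complex) \<Rightarrow> 'w::zero \<Rightarrow> 'w) \<Rightarrow> int \<Rightarrow> 'w \<Rightarrow> 'w" where
  "L_series p \<rho> k = (if int p dvd k then \<rho> (bas (L (- (k div int p) - 2))) else (\<lambda>w. 0))"

definition I_series ::
  "nat \<Rightarrow> ((gap_gen \<Rightarrow>\<^sub>0 complex) \<Rightarrow> 'w::zero \<Rightarrow> 'w) \<Rightarrow> nat \<Rightarrow> int \<Rightarrow> 'w \<Rightarrow> 'w" where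
  "I_series p \<rho> i k =
     (if int p dvd k + int i then \<rho> (bas (I i (- ((k + int i) div int p) - 1))) else (\<lambda>w. 0))"


section \<open>The Lie algebra \<open>\<N>\<^sub>p\<close> and its vertex algebra\<close>

datatype np_gen = T int | N nat int | K nat

definition np_basis :: "nat \<Rightarrow> np_gen set" where
  "np_basis p =
     {T m | m. True} \<union> {N i m | i m. 1 \<le> i \<and> i \<le> p - 1} \<union> {K j | j. j \<le> p div 2}"

fun np_br :: "nat \<Rightarrow> np_gen \<Rightarrow> np_gen \<Rightarrow> (np_gen \<Rightarrow>\<^sub>0 complex)" where
  "np_br p (T m) (T n) =
     pscale (of_int (m - n)) (bas (T (m + n))) +
     (if m + n = 0 then pscale (of_int (m ^ 3 - m) / 12) (bas (K 0)) else 0)"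
| "np_br p (T m) (N i n) = pscale (- of_int n) (bas (N i (m + n)))"
| "np_br p (N i n) (T m) = pscale (of_int n) (bas (N i (m + n)))"
| "np_br p (N i m) (N j n) =
     (if i + j = p \<and> m + n = 0 then pscale (of_int m) (bas (K (fold_index p i))) else 0)"
| "np_br p (K j) _ = 0"
| "np_br p _ (K j) = 0"

definition np_sub :: "nat \<Rightarrow> np_gen set" where
  "np_sub p =
     {T m | m. m \<ge> -1} \<union> {N i n | i n. 1 \<le> i \<and> i \<le> p - 1 \<and> n \<ge> 0} \<union> {K j | j. j \<le> p div 2}"

fun np_char :: "(nat \<Rightarrow> complex) \<Rightarrow> np_gen \<Rightarrow> complex" where
  "np_char l (T m) = 0"
| "np_char l (N i n) = 0"
| "np_char l (K j) = l j"

type_synonym np_elt = "(np_gen fword \<Rightarrow>\<^sub>0 complex) set"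

definition V_np :: "nat \<Rightarrow> (nat \<Rightarrow> complex) \<Rightarrow> (complex, np_elt) module" where
  "V_np p l = ind_module (np_basis p) (np_br p) (np_sub p) (np_char l)"

definition np_act :: "nat \<Rightarrow> (nat \<Rightarrow> complex) \<Rightarrow> np_gen \<Rightarrow> np_elt \<Rightarrow> np_elt" where
  "np_act p l g = ind_act (np_basis p) (np_br p) (np_sub p) (np_char l) (bas g)"

definition np_vac :: "nat \<Rightarrow> (nat \<Rightarrow> complex) \<Rightarrow> np_elt" where
  "np_vac p l = cls (ind_rel (np_basis p) (np_br p) (np_sub p) (np_char l)) 1"

text \<open>
  \<open>Y(T\<^sub>-\<^sub>2 1, x) = \<Sum>n. T\<^sub>n x\<^sup>-\<^sup>n\<^sup>-\<^sup>2\<close> and \<open>Y(N\<^sup>i\<^sub>-\<^sub>1 1, x) = \<Sum>n. N\<^sup>i\<^sub>n x\<^sup>-\<^sup>n\<^sup>-\<^sup>1\<close>. Since the coefficients of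
  these series generate the space from the vacuum, at most one vertex algebra structure with this
  vacuum satisfies these equations.
\<close>

definition np_vertex_structure ::
  "nat \<Rightarrow> (nat \<Rightarrow> complex) \<Rightarrow> (np_elt \<Rightarrow> int \<Rightarrow> np_elt \<Rightarrow> np_elt) \<Rightarrow> bool" where
  "np_vertex_structure p l Y \<longleftrightarrow>
     vertex_algebra (V_np p l) (np_vac p l) Y \<and>
     (\<forall>v\<in>carrier (V_np p l). \<forall>m.
        Y (np_act p l (T (-2)) (np_vac p l)) m v = np_act p l (T (- m - 2)) v) \<and>
     (\<forall>i\<in>{1..p-1}. \<forall>v\<in>carrier (V_np p l). \<forall>m.
        Y (np_act p l (N i (-1)) (np_vac p l)) m v = np_act p l (N i (- m - 1)) v)"

text \<open>
  The automorphism \<open>\<sigma>\<^sub>p\<close> is diagonal in the given basis, with \<open>N\<^sup>i\<^sub>m \<mapsto> \<xi>\<^sup>i N\<^sup>i\<^sub>m\<close>. With the eigenvalue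
  \<open>\<xi>\<close> on all \<open>N\<^sup>i\<^sub>m\<close> instead, \<open>Y\<^sub>W(N\<^sup>i\<^sub>-\<^sub>1 1, x)\<close> would have exponents in \<open>-1/p + \<int>\<close>, whereas the exponents
  of \<open>\<Sum>n. I\<^sup>i(n) x\<^sup>-\<^sup>n\<^sup>-\<^sup>i\<^sup>/\<^sup>p\<^sup>-\<^sup>1\<close> lie in \<open>-i/p + \<int>\<close>. As \<open>\<xi>\<^sup>i \<xi>\<^sup>p\<^sup>-\<^sup>i = 1\<close>, the central elements are
  fixed.
\<close>

fun sigma_eigenvalue :: "complex \<Rightarrow> np_gen \<Rightarrow> complex" where
  "sigma_eigenvalue \<xi> (T m) = 1"
| "sigma_eigenvalue \<xi> (N i m) = \<xi> ^ i"
| "sigma_eigenvalue \<xi> (K j) = 1"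

definition sigma_free ::
  "complex \<Rightarrow> (np_gen fword \<Rightarrow>\<^sub>0 complex) \<Rightarrow> (np_gen fword \<Rightarrow>\<^sub>0 complex)" where
  "sigma_free \<xi> =
     Poly_Mapping.mapp (\<lambda>u c. prod_list (map (sigma_eigenvalue \<xi>) (letters u)) * c)"

text \<open>
  The induced map on the quotient: the relations are stable under \<open>sigma_free\<close>, so the image of
  a coset is the coset of the image.
\<close>

definition sigma_np :: "complex \<Rightarrow> np_elt \<Rightarrow> np_elt" where
  "sigma_np \<xi> X = sigma_free \<xi> ` X"

definition primitive_root :: "nat \<Rightarrow> complex \<Rightarrow> bool" where
  "primitive_root p \<xi> \<longleftrightarrow> \<xi> ^ p = 1 \<and> (\<forall>k. 0 < k \<and> k < p \<longrightarrow> \<xi> ^ k \<noteq> 1)"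

definition level0 :: "complex \<Rightarrow> nat \<Rightarrow> complex" where
  "level0 l j = (if j = 0 then l else 0)"

end

theory Submission
  imports Defs
begin

text \<open>
  Restricted \<open>\<gg>\<^sub>p\<close>-modules arise from twisted modules because the commutation relations of the modes of
  \<open>Y\<^sub>W(u,x)\<close> and \<open>Y\<^sub>W(v,x)\<close> depend only on the finitely many products \<open>u\<^sub>k v\<close>, \<open>k \<ge> 0\<close>, in the vertex
  algebra. The residue in \<open>x\<^sub>0\<close> of the twisted Jacobi identity expresses \<open>[Y\<^sub>W(u,x\<^sub>1), Y\<^sub>W(v,x\<^sub>2)]\<close> through
  the series \<open>Y\<^sub>W(u\<^sub>k v, x\<^sub>2)\<close> with binomial coefficients in the exponent of \<open>x\<^sub>1\<close>
  (\<open>twisted_commutator\<close>).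

  For the generators \<open>\<omega> = T\<^sub>-\<^sub>2\<one>\<close> and \<open>N\<^sup>i\<^sub>-\<^sub>1\<one>\<close> these products follow from single brackets of \<open>\<N>\<^sub>p\<close>,
  since nonnegative modes annihilate the vacuum (\<open>np_act_T_T\<close>, \<open>np_act_T_N\<close>, \<open>np_act_N_N\<close>). They are
  multiples of the generators themselves, of the vacuum, and of the translates \<open>T\<^sub>-\<^sub>3\<one>\<close> and \<open>N\<^sup>i\<^sub>-\<^sub>2\<one>\<close>,
  whose vertex operators are derivatives of those of the generators (\<open>twisted_derivative\<close>). So the
  modes of the generators, together with scalars, close under commutators. The structure constants are
  those of \<open>\<N>\<^sub>p\<close> with the mode index of \<open>N\<^sup>i\<close> shifted by \<open>i/p\<close>, because \<open>N\<^sup>i\<^sub>-\<^sub>1\<one>\<close> is an eigenvector of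
  \<open>\<sigma>\<^sub>p\<close> for \<open>\<xi>\<^sup>i\<close> and its vertex operator therefore has exponents in \<open>-i/p + \<int>\<close>; this is exactly
  the bracket of \<open>\<gg>\<^sub>p\<close>. Truncation of twisted vertex operators makes the module restricted.

  Two points need care with the concrete construction of the vacuum module as a quotient of a free
  algebra: the quotient is by a left ideal, so that modes act on cosets (\<open>rel_left_ideal\<close>), and
  this ideal is mapped onto itself by \<open>\<sigma>\<^sub>p\<close>, so that the generators are indeed eigenvectors
  (\<open>rescale_cls\<close>).
\<close>

section \<open>Finitely supported coefficient functions\<close>

lemma lookup_pscale [simp]: "Poly_Mapping.lookup (pscale c f) k = c * Poly_Mapping.lookup f k"
  by (simp add: pscale_def Poly_Mapping.map.rep_eq when_def)

interpretation pscale: vector_space pscale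
  by unfold_locales (rule poly_mapping_eqI, simp add: lookup_add algebra_simps)+

lemma pscale_single [simp]: "pscale c (Poly_Mapping.single k d) = Poly_Mapping.single k (c * d)"
  by (rule poly_mapping_eqI) (simp add: lookup_single when_def)

lemma keys_pscale_subset: "Poly_Mapping.keys (pscale c f) \<subseteq> Poly_Mapping.keys f"
  by (auto simp: in_keys_iff)

lemma sum_singles: "(\<Sum>k\<in>Poly_Mapping.keys f. Poly_Mapping.single k (Poly_Mapping.lookup f k)) = f"
  by (rule poly_mapping_eqI)
     (simp add: lookup_sum lookup_single when_def sum.delta' in_keys_iff)

lemma poly_mapping_single_induct [case_names single add]:
  fixes f :: "'k \<Rightarrow>\<^sub>0 'c::comm_monoid_add"
  assumes single: "\<And>k c. P (Poly_Mapping.single k c)"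
    and add: "\<And>f g. P f \<Longrightarrow> P g \<Longrightarrow> P (f + g)"
  shows "P f"
proof -
  have "P (\<Sum>k\<in>A. Poly_Mapping.single k (Poly_Mapping.lookup f k))" if "finite A" for A
    using that
  proof (induction A rule: finite_induct)
    case empty
    then show ?case using single[of undefined 0] by simp
  next
    case (insert k A)
    then show ?case by (simp add: add single)
  qed
  from this[of "Poly_Mapping.keys f"] show ?thesis by (simp add: sum_singles)
qed

lemma pscale_conv_mult: "pscale c f = Poly_Mapping.single 0 c * f"
  unfolding pscale_def by (rule mult_map_scale_conv_mult)

text \<open>
  The monoid of exponents need not be commutative, but scalars sit at its unit; hence scalars can be
  moved past the left factor of a product.
\<close>

lemma single_zero_central:
  fixes f :: "'k::monoid_add \<Rightarrow>\<^sub>0 complex"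
  shows "f * Poly_Mapping.single 0 c = Poly_Mapping.single 0 c * f"
  by (induction f rule: poly_mapping_single_induct)
     (simp_all add: mult_single algebra_simps)

lemma pscale_mult_right: "f * pscale c g = pscale c (f * g)"
  by (metis mult.assoc pscale_conv_mult single_zero_central)

lemma keys_bas [simp]: "Poly_Mapping.keys (bas g) = {g}"
  by (simp add: bas_def)

lemma lookup_bas: "Poly_Mapping.lookup (bas g) h = (if g = h then 1 else 0)"
  by (simp add: bas_def lookup_single when_def)

lemma bas_in_lie_carrier_iff [simp]: "bas g \<in> lie_carrier B \<longleftrightarrow> g \<in> B"
  by (simp add: lie_carrier_def)

lemma lie_carrier_add: "x \<in> lie_carrier B \<Longrightarrow> y \<in> lie_carrier B \<Longrightarrow> x + y \<in> lie_carrier B"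
  using keys_add[of x y] unfolding lie_carrier_def by blast

lemma lie_carrier_pscale: "x \<in> lie_carrier B \<Longrightarrow> pscale c x \<in> lie_carrier B"
  using keys_pscale_subset[of c x] unfolding lie_carrier_def by blast

lemma lie_bracket_bas [simp]: "lie_bracket br (bas g) (bas h) = br g h"
  by (simp add: lie_bracket_def lookup_bas)

section \<open>The free algebra\<close>

text \<open>
  Reading \<open>iota x\<close> off word by word reduces every identity about \<open>iota\<close> to one about coefficients.
\<close>

lemma lookup_iota: "Poly_Mapping.lookup (iota x) u =
    (case letters u of [g] \<Rightarrow> Poly_Mapping.lookup x g | _ \<Rightarrow> 0)"
proof -
  have *: "(FWord [g] = u) \<longleftrightarrow> letters u = [g]" for g
    by (cases u) auto
  show ?thesis
    by (auto simp: iota_def lookup_sum lookup_single when_def * in_keys_iff sum.delta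
        split: list.split)
qed

lemma iota_add: "iota (x + y) = iota x + iota y"
  by (rule poly_mapping_eqI) (simp add: lookup_iota lookup_add split: list.split)

lemma iota_zero [simp]: "iota 0 = 0"
  by (simp add: iota_def)

lemma iota_pscale: "iota (pscale c x) = pscale c (iota x)"
  by (rule poly_mapping_eqI) (simp add: lookup_iota split: list.split)

lemma iota_bas: "iota (bas g) = Poly_Mapping.single (FWord [g]) 1"
  by (simp add: iota_def lookup_bas)

lemma one_in_free_alg [simp]: "1 \<in> free_alg B"
  by (simp add: free_alg_def zero_fword_def)

lemma mult_in_free_alg:
  assumes "f \<in> free_alg B" "g \<in> free_alg B"
  shows "f * g \<in> free_alg B"
  using assms keys_mult[of f g] by (fastforce simp: free_alg_def plus_fword_def)

lemma iota_in_free_alg_iff [simp]: "iota x \<in> free_alg B \<longleftrightarrow> x \<in> lie_carrier B"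
proof
  assume "iota x \<in> free_alg B"
  then have "\<forall>u. Poly_Mapping.lookup (iota x) u \<noteq> 0 \<longrightarrow> set (letters u) \<subseteq> B"
    by (simp add: free_alg_def in_keys_iff)
  then have "\<forall>g. Poly_Mapping.lookup x g \<noteq> 0 \<longrightarrow> g \<in> B"
    by (metis (no_types, lifting) fword.sel list.case list.set_intros(1) lookup_iota subsetD)
  then show "x \<in> lie_carrier B"
    by (auto simp: lie_carrier_def in_keys_iff)
qed (auto simp: free_alg_def lie_carrier_def in_keys_iff lookup_iota split: list.splits)

lemma char_ext_add: "char_ext \<chi> (f + g) = char_ext \<chi> f + char_ext \<chi> g"
  unfolding char_ext_def
  by (rule setsum_keys_plus_distrib) (simp_all add: algebra_simps)

lemma char_ext_single:
  "char_ext \<chi> (Poly_Mapping.single u c) = c * prod_list (map \<chi> (letters u))"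
  by (simp add: char_ext_def)

lemma char_ext_pscale: "char_ext \<chi> (pscale c f) = c * char_ext \<chi> f"
  by (induction f rule: poly_mapping_single_induct)
     (simp_all add: char_ext_single char_ext_add pscale.scale_right_distrib algebra_simps)

lemma char_ext_zero [simp]: "char_ext \<chi> 0 = 0"
  by (simp add: char_ext_def)

lemma char_ext_iota_bas: "char_ext \<chi> (iota (bas g)) = \<chi> g"
  by (simp add: iota_bas char_ext_single)


section \<open>Induced modules\<close>

lemma uea_relI:
  assumes "a \<in> free_alg B" "b \<in> free_alg B" "x \<in> lie_carrier B" "y \<in> lie_carrier B"
  shows "a * (iota x * iota y - iota y * iota x - iota (lie_bracket br x y)) * b \<in> uea_rel B br"
  unfolding uea_rel_def mem_Collect_eq
  by (rule exI[of _ a], rule exI[of _ b], rule exI[of _ x], rule exI[of _ y]) (simp add: assms)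

locale induced =
  fixes B :: "'g set" and br :: "'g \<Rightarrow> 'g \<Rightarrow> ('g \<Rightarrow>\<^sub>0 complex)"
    and S :: "'g set" and \<chi> :: "'g \<Rightarrow> complex"
  assumes S_subset: "S \<subseteq> B"
    and bracket_closed: "a \<in> B \<Longrightarrow> b \<in> B \<Longrightarrow> Poly_Mapping.keys (br a b) \<subseteq> B"
begin

abbreviation "R \<equiv> ind_rel B br S \<chi>"
abbreviation "act \<equiv> ind_act B br S \<chi>"
abbreviation "M \<equiv> ind_module B br S \<chi>"

lemma subspace_rel: "pscale.subspace R"
  unfolding ind_rel_def by (rule pscale.subspace_span)

lemmas rel_zero = pscale.subspace_0[OF subspace_rel]
  and rel_add = pscale.subspace_add[OF subspace_rel]
  and rel_diff = pscale.subspace_diff[OF subspace_rel]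
  and rel_scale = pscale.subspace_scale[OF subspace_rel]

text \<open>
  The two kinds of generators of the relations, in the form in which they are used: commutators
  become brackets, and elements of the subalgebra standing on the right are evaluated by the
  character.
\<close>

lemma rel_commutator:
  assumes "x \<in> lie_carrier B" "y \<in> lie_carrier B"
  shows "iota x * iota y - iota y * iota x - iota (lie_bracket br x y) \<in> R"
  unfolding ind_rel_def
  using uea_relI[OF one_in_free_alg one_in_free_alg assms, of br]
  by (simp add: pscale.span_base)

lemma rel_balance:
  "a \<in> free_alg B \<Longrightarrow> b \<in> free_alg S \<Longrightarrow> a * b - pscale (char_ext \<chi> b) a \<in> R"
  unfolding ind_rel_def by (auto intro: pscale.span_base)

text \<open>
  This makes the algebra act on the cosets. Both kinds of generators stay of the same kind under
  multiplication by \<open>a\<close>, which is absorbed into the left factor that they already carry.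
\<close>

lemma rel_left_ideal:
  assumes a: "a \<in> free_alg B" and "r \<in> R"
  shows "a * r \<in> R"
  using assms(2) unfolding ind_rel_def
proof (induction rule: pscale.span_induct_alt)
  case base
  then show ?case by (simp add: pscale.span_zero)
next
  case (step c x y)
  have "a * x \<in> uea_rel B br \<union>
      {a * b - pscale (char_ext \<chi> b) a | a b. a \<in> free_alg B \<and> b \<in> free_alg S}"
    using step.hyps
  proof
    assume "x \<in> uea_rel B br"
    then obtain a' b x' y' where *: "x = a' * (iota x' * iota y' - iota y' * iota x' -
        iota (lie_bracket br x' y')) * b"
      "a' \<in> free_alg B" "b \<in> free_alg B" "x' \<in> lie_carrier B" "y' \<in> lie_carrier B"
      unfolding uea_rel_def by blast
    have "a * x = (a * a') * (iota x' * iota y' - iota y' * iota x' -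
        iota (lie_bracket br x' y')) * b"
      by (simp add: * mult.assoc)
    then have "a * x \<in> uea_rel B br"
      using uea_relI[OF mult_in_free_alg[OF a *(2)] *(3-5)] by (simp only:)
    then show ?thesis ..
  next
    assume "x \<in> {a * b - pscale (char_ext \<chi> b) a | a b. a \<in> free_alg B \<and> b \<in> free_alg S}"
    then obtain a' b where *: "x = a' * b - pscale (char_ext \<chi> b) a'"
      "a' \<in> free_alg B" "b \<in> free_alg S" by blast
    have "a * x = (a * a') * b - pscale (char_ext \<chi> b) (a * a')"
      by (simp add: * right_diff_distrib mult.assoc pscale_mult_right)
    then show ?thesis
      using * mult_in_free_alg[OF a] by blast
  qed
  then show ?case
    using step.IH by (simp add: distrib_left pscale_mult_right pscale.span_add pscale.span_scale
        pscale.span_base)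
qed

lemma mem_cls_iff: "z \<in> cls R f \<longleftrightarrow> z - f \<in> R"
proof
  assume "z - f \<in> R"
  moreover have "z = f + (z - f)" by simp
  ultimately show "z \<in> cls R f"
    unfolding cls_def by blast
qed (auto simp: cls_def)

lemma self_in_cls: "f \<in> cls R f"
  by (simp add: mem_cls_iff rel_zero)

lemma cls_eq_iff: "cls R f = cls R g \<longleftrightarrow> f - g \<in> R"
proof
  assume "cls R f = cls R g"
  then show "f - g \<in> R"
    using self_in_cls[of f] by (simp add: mem_cls_iff)
next
  assume *: "f - g \<in> R"
  have "z - f \<in> R \<longleftrightarrow> z - g \<in> R" for z
    using rel_add[OF _ *, of "z - f"] rel_diff[OF _ *, of "z - g"] by auto
  then show "cls R f = cls R g"
    by (auto simp: mem_cls_iff)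
qed

lemma cls_in_carrier: "f \<in> free_alg B \<Longrightarrow> cls R f \<in> carrier M"
  by (simp add: ind_module_def quotient_space_def)

lemma smult_cls: "c \<odot>\<^bsub>M\<^esub> cls R f = cls R (pscale c f)"
proof -
  have "{pscale c x + r | x r. x \<in> cls R f \<and> r \<in> R} = cls R (pscale c f)"
  proof (intro equalityI subsetI)
    fix z assume "z \<in> {pscale c x + r | x r. x \<in> cls R f \<and> r \<in> R}"
    then obtain x r where *: "z = pscale c x + r" "x - f \<in> R" "r \<in> R"
      by (auto simp: mem_cls_iff)
    have "z - pscale c f = pscale c (x - f) + r"
      by (simp add: * pscale.scale_right_diff_distrib)
    also have "\<dots> \<in> R"
      by (intro rel_add rel_scale *)
    finally show "z \<in> cls R (pscale c f)"
      by (simp only: mem_cls_iff)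
  next
    fix z assume "z \<in> cls R (pscale c f)"
    then obtain r where "z = pscale c f + r" "r \<in> R"
      by (auto simp: cls_def)
    then show "z \<in> {pscale c x + r | x r. x \<in> cls R f \<and> r \<in> R}"
      using self_in_cls[of f] by blast
  qed
  then show ?thesis
    by (simp add: ind_module_def quotient_space_def)
qed

lemma act_cls:
  assumes "x \<in> lie_carrier B"
  shows "act x (cls R f) = cls R (iota x * f)"
proof (intro equalityI subsetI)
  fix z assume "z \<in> act x (cls R f)"
  then obtain y r where *: "z = iota x * y + r" "y - f \<in> R" "r \<in> R"
    by (auto simp: ind_act_def mem_cls_iff)
  have "z - iota x * f = iota x * (y - f) + r"
    by (simp add: * right_diff_distrib)
  also have "\<dots> \<in> R"
    using assms by (intro rel_add rel_left_ideal *) simp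
  finally show "z \<in> cls R (iota x * f)"
    by (simp only: mem_cls_iff)
next
  fix z assume "z \<in> cls R (iota x * f)"
  then obtain r where "z = iota x * f + r" "r \<in> R"
    by (auto simp: cls_def)
  then show "z \<in> act x (cls R f)"
    unfolding ind_act_def using self_in_cls[of f] by blast
qed

text \<open>
  Because \<open>g\<close> kills the vacuum, \<open>g h \<one> = [g,h] \<one> + h g \<one>\<close> reduces to the first summand: a product of
  two modes acting on the vacuum is read off from a single bracket.
\<close>

lemma act_act_vacuum:
  assumes "g \<in> S" "\<chi> g = 0" "h \<in> B"
  shows "act (bas g) (act (bas h) (cls R 1)) = cls R (iota (br g h))"
proof -
  have B: "g \<in> B" "h \<in> B"
    using assms S_subset by auto
  have "iota (bas g) * iota (bas h) - iota (bas h) * iota (bas g) - iota (br g h) \<in> R"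
    using rel_commutator[of "bas g" "bas h"] B by simp
  moreover have "iota (bas h) * iota (bas g) \<in> R"
    using rel_balance[of "iota (bas h)" "iota (bas g)"] assms
    by (simp add: char_ext_iota_bas)
  ultimately have "iota (bas g) * iota (bas h) - iota (br g h) \<in> R"
    using rel_add by fastforce
  then show ?thesis
    using B by (simp add: act_cls cls_eq_iff)
qed

lemma act_act_vacuum_scale:
  assumes "g \<in> S" "\<chi> g = 0" "h \<in> B" "br g h = pscale c (bas h')" "h' \<in> B"
  shows "act (bas g) (act (bas h) (cls R 1)) = c \<odot>\<^bsub>M\<^esub> act (bas h') (cls R 1)"
  unfolding act_act_vacuum[OF assms(1-3)] using assms(4,5)
  by (simp add: iota_pscale act_cls smult_cls)

text \<open>
  If the bracket falls back into the subalgebra, the balancing relation turns it into a multiple of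
  the vacuum. The central terms of the operator products below arise in this way.
\<close>

lemma act_act_vacuum_character:
  assumes "g \<in> S" "\<chi> g = 0" "h \<in> B" "br g h \<in> lie_carrier S"
  shows "act (bas g) (act (bas h) (cls R 1)) = char_ext \<chi> (iota (br g h)) \<odot>\<^bsub>M\<^esub> cls R 1"
  unfolding act_act_vacuum[OF assms(1-3)] using assms(4) rel_balance[of 1 "iota (br g h)"]
  by (simp add: smult_cls cls_eq_iff)

end


section \<open>Diagonal automorphisms\<close>

text \<open>
  The algebra endomorphism determined by \<open>g \<mapsto> \<epsilon> g \<cdot> g\<close>; the map \<open>sigma_free \<xi>\<close> is the case of the
  weights \<open>sigma_eigenvalue \<xi>\<close>.
\<close>

definition rescale :: "('g \<Rightarrow> complex) \<Rightarrow> ('g fword \<Rightarrow>\<^sub>0 complex) \<Rightarrow> ('g fword \<Rightarrow>\<^sub>0 complex)" where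
  "rescale \<epsilon> = Poly_Mapping.mapp (\<lambda>u c. prod_list (map \<epsilon> (letters u)) * c)"

definition rescale_lie :: "('g \<Rightarrow> complex) \<Rightarrow> ('g \<Rightarrow>\<^sub>0 complex) \<Rightarrow> ('g \<Rightarrow>\<^sub>0 complex)" where
  "rescale_lie \<epsilon> = Poly_Mapping.mapp (\<lambda>g c. \<epsilon> g * c)"

lemma lookup_rescale [simp]:
  "Poly_Mapping.lookup (rescale \<epsilon> f) u = prod_list (map \<epsilon> (letters u)) * Poly_Mapping.lookup f u"
  by (simp add: rescale_def lookup_mapp when_def in_keys_iff)

lemma lookup_rescale_lie [simp]:
  "Poly_Mapping.lookup (rescale_lie \<epsilon> x) g = \<epsilon> g * Poly_Mapping.lookup x g"
  by (simp add: rescale_lie_def lookup_mapp when_def in_keys_iff)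

lemma linear_rescale_lie: "Vector_Spaces.linear pscale pscale (rescale_lie \<epsilon>)"
  by unfold_locales (rule poly_mapping_eqI, simp add: lookup_add algebra_simps)+

lemma rescale_add: "rescale \<epsilon> (f + g) = rescale \<epsilon> f + rescale \<epsilon> g"
  by (rule poly_mapping_eqI) (simp add: lookup_add algebra_simps)

lemma rescale_diff: "rescale \<epsilon> (f - g) = rescale \<epsilon> f - rescale \<epsilon> g"
  by (rule poly_mapping_eqI) (simp add: lookup_minus algebra_simps)

lemma rescale_pscale: "rescale \<epsilon> (pscale c f) = pscale c (rescale \<epsilon> f)"
  by (rule poly_mapping_eqI) simp

lemma rescale_single:
  "rescale \<epsilon> (Poly_Mapping.single u c) = Poly_Mapping.single u (prod_list (map \<epsilon> (letters u)) * c)"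
  by (rule poly_mapping_eqI) (simp add: lookup_single when_def)

lemma rescale_mult: "rescale \<epsilon> (f * g) = rescale \<epsilon> f * rescale \<epsilon> g"
proof (induction f rule: poly_mapping_single_induct)
  case (single u c)
  show ?case
    by (induction g rule: poly_mapping_single_induct)
       (simp_all add: rescale_single rescale_add mult_single distrib_left plus_fword_def ac_simps)
qed (simp add: rescale_add distrib_right)

lemma rescale_iota: "rescale \<epsilon> (iota x) = iota (rescale_lie \<epsilon> x)"
  by (rule poly_mapping_eqI) (simp add: lookup_iota split: list.split)

lemma rescale_in_free_alg: "f \<in> free_alg B \<Longrightarrow> rescale \<epsilon> f \<in> free_alg B"
  by (auto simp: free_alg_def in_keys_iff)

lemma rescale_lie_in_carrier: "x \<in> lie_carrier B \<Longrightarrow> rescale_lie \<epsilon> x \<in> lie_carrier B"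
  by (auto simp: lie_carrier_def in_keys_iff)

lemma rescale_rescale:
  assumes "\<And>g. \<epsilon> g * \<epsilon>' g = 1"
  shows "rescale \<epsilon> (rescale \<epsilon>' f) = f"
proof (rule poly_mapping_eqI)
  fix u
  have "prod_list (map \<epsilon> gs) * prod_list (map \<epsilon>' gs) = 1" for gs
  proof (induction gs)
    case (Cons g gs)
    have "prod_list (map \<epsilon> (g # gs)) * prod_list (map \<epsilon>' (g # gs)) =
        (\<epsilon> g * \<epsilon>' g) * (prod_list (map \<epsilon> gs) * prod_list (map \<epsilon>' gs))"
      by (simp only: list.map prod_list.Cons ac_simps)
    then show ?case
      using assms Cons by simp
  qed simp
  then show "Poly_Mapping.lookup (rescale \<epsilon> (rescale \<epsilon>' f)) u = Poly_Mapping.lookup f u"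
    by (simp flip: mult.assoc)
qed

text \<open>
  Letters with a nonzero character value have weight 1, and any other letter makes both sides vanish
  on a word in which it occurs.
\<close>

lemma char_ext_rescale:
  assumes "b \<in> free_alg S" "\<And>g. g \<in> S \<Longrightarrow> \<epsilon> g * \<chi> g = \<chi> g" "\<And>g. \<epsilon> g \<noteq> 0"
  shows "char_ext \<chi> (rescale \<epsilon> b) = char_ext \<chi> b"
proof -
  have nonzero: "prod_list (map \<epsilon> gs) \<noteq> 0" for gs
    using assms(3) by (induction gs) auto
  have prod: "prod_list (map \<epsilon> gs) * prod_list (map \<chi> gs) = prod_list (map \<chi> gs)"
    if "set gs \<subseteq> S" for gs
    using that
  proof (induction gs)
    case (Cons g gs)
    have g: "\<epsilon> g * \<chi> g = \<chi> g"
      using assms(2) Cons.prems by simp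
    have gs: "prod_list (map \<epsilon> gs) * prod_list (map \<chi> gs) = prod_list (map \<chi> gs)"
      using Cons.prems by (intro Cons.IH) simp
    have "prod_list (map \<epsilon> (g # gs)) * prod_list (map \<chi> (g # gs)) =
        (\<epsilon> g * \<chi> g) * (prod_list (map \<epsilon> gs) * prod_list (map \<chi> gs))"
      by (simp only: list.map prod_list.Cons ac_simps)
    then show ?case
      by (simp only: g gs list.map prod_list.Cons)
  qed simp
  have "Poly_Mapping.keys (rescale \<epsilon> b) = Poly_Mapping.keys b"
    using nonzero by (auto simp: in_keys_iff)
  moreover have "Poly_Mapping.lookup (rescale \<epsilon> b) u * prod_list (map \<chi> (letters u)) =
      Poly_Mapping.lookup b u * prod_list (map \<chi> (letters u))" if "u \<in> Poly_Mapping.keys b" for u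
  proof -
    have "set (letters u) \<subseteq> S"
      using that assms(1) by (auto simp: free_alg_def)
    from prod[OF this] show ?thesis
      by (simp add: ac_simps)
  qed
  ultimately show ?thesis
    unfolding char_ext_def by (simp only: cong: sum.cong)
qed

lemma rescale_lie_bracket:
  assumes nonzero: "\<And>g. \<epsilon> g \<noteq> 0"
    and graded: "\<And>a b g. a \<in> B \<Longrightarrow> b \<in> B \<Longrightarrow> g \<in> Poly_Mapping.keys (br a b) \<Longrightarrow> \<epsilon> g = \<epsilon> a * \<epsilon> b"
    and x: "x \<in> lie_carrier B" and y: "y \<in> lie_carrier B"
  shows "rescale_lie \<epsilon> (lie_bracket br x y) =
    lie_bracket br (rescale_lie \<epsilon> x) (rescale_lie \<epsilon> y)"
proof -
  have keys: "Poly_Mapping.keys (rescale_lie \<epsilon> z) = Poly_Mapping.keys z" for z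
    using nonzero by (auto simp: in_keys_iff)
  have homogeneous: "rescale_lie \<epsilon> (pscale c (br a b)) = pscale (c * (\<epsilon> a * \<epsilon> b)) (br a b)"
    if "a \<in> Poly_Mapping.keys x" "b \<in> Poly_Mapping.keys y" for a b c
  proof (rule poly_mapping_eqI)
    fix g
    have "a \<in> B" "b \<in> B"
      using that x y by (auto simp: lie_carrier_def)
    then show "Poly_Mapping.lookup (rescale_lie \<epsilon> (pscale c (br a b))) g =
        Poly_Mapping.lookup (pscale (c * (\<epsilon> a * \<epsilon> b)) (br a b)) g"
      using graded[of a b g] by (cases "g \<in> Poly_Mapping.keys (br a b)") (auto simp: in_keys_iff)
  qed
  have "rescale_lie \<epsilon> (lie_bracket br x y) =
      (\<Sum>a\<in>Poly_Mapping.keys x. \<Sum>b\<in>Poly_Mapping.keys y. rescale_lie \<epsilon>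
        (pscale (Poly_Mapping.lookup x a * Poly_Mapping.lookup y b) (br a b)))"
    unfolding lie_bracket_def
    by (simp add: module_hom.sum[OF linear_rescale_lie[unfolded linear_iff_module_hom]])
  also have "\<dots> = lie_bracket br (rescale_lie \<epsilon> x) (rescale_lie \<epsilon> y)"
    unfolding lie_bracket_def keys by (intro sum.cong refl) (simp add: homogeneous ac_simps)
  finally show ?thesis .
qed

context induced
begin

text \<open>
  An automorphism of the Lie algebra that fixes the character carries each defining relation of the
  induced module to one of the same kind, so it acts on the quotient.
\<close>

lemma rescale_rel:
  assumes nonzero: "\<And>g. \<epsilon> g \<noteq> 0"
    and graded: "\<And>a b g. a \<in> B \<Longrightarrow> b \<in> B \<Longrightarrow> g \<in> Poly_Mapping.keys (br a b) \<Longrightarrow> \<epsilon> g = \<epsilon> a * \<epsilon> b"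
    and invariant: "\<And>g. g \<in> S \<Longrightarrow> \<epsilon> g * \<chi> g = \<chi> g"
    and "r \<in> R"
  shows "rescale \<epsilon> r \<in> R"
  using assms(4) unfolding ind_rel_def
proof (induction rule: pscale.span_induct_alt)
  case base
  then show ?case
    using pscale.span_zero rescale_pscale[of \<epsilon> 0 0] by simp
next
  case (step c x y)
  have "rescale \<epsilon> x \<in> uea_rel B br \<union>
      {a * b - pscale (char_ext \<chi> b) a | a b. a \<in> free_alg B \<and> b \<in> free_alg S}"
    using step.hyps
  proof
    assume "x \<in> uea_rel B br"
    then obtain a b x' y' where *: "x = a * (iota x' * iota y' - iota y' * iota x' -
        iota (lie_bracket br x' y')) * b"
      "a \<in> free_alg B" "b \<in> free_alg B" "x' \<in> lie_carrier B" "y' \<in> lie_carrier B"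
      unfolding uea_rel_def by blast
    then have "rescale \<epsilon> x = rescale \<epsilon> a * (iota (rescale_lie \<epsilon> x') * iota (rescale_lie \<epsilon> y') -
        iota (rescale_lie \<epsilon> y') * iota (rescale_lie \<epsilon> x') -
        iota (lie_bracket br (rescale_lie \<epsilon> x') (rescale_lie \<epsilon> y'))) * rescale \<epsilon> b"
      by (simp add: rescale_mult rescale_diff rescale_iota rescale_lie_bracket[OF nonzero graded])
    then have "rescale \<epsilon> x \<in> uea_rel B br"
      using uea_relI[OF *(2,3)[THEN rescale_in_free_alg] *(4,5)[THEN rescale_lie_in_carrier]]
      by (simp only:)
    then show ?thesis ..
  next
    assume "x \<in> {a * b - pscale (char_ext \<chi> b) a | a b. a \<in> free_alg B \<and> b \<in> free_alg S}"
    then obtain a b where *: "x = a * b - pscale (char_ext \<chi> b) a"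
      "a \<in> free_alg B" "b \<in> free_alg S" by blast
    then have "rescale \<epsilon> x =
        rescale \<epsilon> a * rescale \<epsilon> b - pscale (char_ext \<chi> (rescale \<epsilon> b)) (rescale \<epsilon> a)"
      by (simp add: rescale_mult rescale_diff rescale_pscale
          char_ext_rescale[OF _ invariant nonzero])
    then show ?thesis
      using * rescale_in_free_alg by blast
  qed
  then show ?case
    using step.IH by (simp add: rescale_add rescale_pscale pscale.span_add pscale.span_scale
        pscale.span_base)
qed

text \<open>
  For the image of a coset to be a full coset, the relations have to be mapped onto themselves; the
  rescaling by the inverse weights satisfies the same hypotheses and provides preimages.
\<close>

lemma rescale_cls:
  assumes nonzero: "\<And>g. \<epsilon> g \<noteq> 0"
    and graded: "\<And>a b g. a \<in> B \<Longrightarrow> b \<in> B \<Longrightarrow> g \<in> Poly_Mapping.keys (br a b) \<Longrightarrow> \<epsilon> g = \<epsilon> a * \<epsilon> b"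
    and invariant: "\<And>g. g \<in> S \<Longrightarrow> \<epsilon> g * \<chi> g = \<chi> g"
  shows "rescale \<epsilon> ` cls R f = cls R (rescale \<epsilon> f)"
proof -
  define \<epsilon>' where "\<epsilon>' = (\<lambda>g. inverse (\<epsilon> g))"
  have inverse: "rescale \<epsilon> (rescale \<epsilon>' r) = r" for r
    by (rule rescale_rescale) (simp add: \<epsilon>'_def nonzero)
  have "rescale \<epsilon>' r \<in> R" if "r \<in> R" for r
  proof (rule rescale_rel[OF _ _ _ that])
    show "\<epsilon>' g \<noteq> 0" for g
      by (simp add: \<epsilon>'_def nonzero)
    show "\<epsilon>' g = \<epsilon>' a * \<epsilon>' b" if "a \<in> B" "b \<in> B" "g \<in> Poly_Mapping.keys (br a b)" for a b g
      using graded[OF that] by (simp add: \<epsilon>'_def)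
    show "\<epsilon>' g * \<chi> g = \<chi> g" if "g \<in> S" for g
      using invariant[OF that] nonzero[of g] by (auto simp: \<epsilon>'_def field_simps)
  qed
  then have "R \<subseteq> rescale \<epsilon> ` R"
    using inverse by (metis image_eqI subsetI)
  moreover have "rescale \<epsilon> ` R \<subseteq> R"
    using rescale_rel[OF nonzero graded invariant] by blast
  ultimately have R: "rescale \<epsilon> ` R = R" by blast
  have cls: "cls R h = (\<lambda>r. h + r) ` R" for h
    by (auto simp: cls_def)
  have "rescale \<epsilon> ` cls R f = (\<lambda>r. rescale \<epsilon> f + r) ` (rescale \<epsilon> ` R)"
    by (simp add: cls image_image rescale_add)
  then show ?thesis
    by (simp only: R cls)
qed

end

section \<open>Lie modules from operators on a basis\<close>

definition lin_ext ::
  "(complex \<Rightarrow> 'w::ab_group_add \<Rightarrow> 'w) \<Rightarrow> ('g \<Rightarrow> 'w \<Rightarrow> 'w) \<Rightarrow> ('g \<Rightarrow>\<^sub>0 complex) \<Rightarrow> 'w \<Rightarrow> 'w" where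
  "lin_ext sc A x w = (\<Sum>g\<in>Poly_Mapping.keys x. sc (Poly_Mapping.lookup x g) (A g w))"

lemma lin_ext_bas:
  assumes "vector_space sc"
  shows "lin_ext sc A (bas g) w = A g w"
  using vector_space.vector_space_assms(4)[OF assms] by (simp add: lin_ext_def lookup_bas)

lemma lin_ext_add:
  assumes "vector_space sc"
  shows "lin_ext sc A (x + y) w = lin_ext sc A x w + lin_ext sc A y w"
proof -
  interpret vector_space sc by fact
  show ?thesis
    unfolding lin_ext_def
    by (rule setsum_keys_plus_distrib) (simp_all add: scale_left_distrib)
qed

lemma lin_ext_pscale:
  assumes "vector_space sc"
  shows "lin_ext sc A (pscale c x) w = sc c (lin_ext sc A x w)"
proof -
  interpret vector_space sc by fact
  have "lin_ext sc A (pscale c x) w =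
      (\<Sum>g\<in>Poly_Mapping.keys x. sc (c * Poly_Mapping.lookup x g) (A g w))"
    unfolding lin_ext_def by (rule sum.mono_neutral_cong_left) (auto simp: in_keys_iff)
  then show ?thesis
    by (simp add: lin_ext_def scale_sum_right)
qed

lemma lin_ext_zero: "lin_ext sc A 0 w = 0"
  by (simp add: lin_ext_def)

lemma lin_ext_sum:
  assumes "vector_space sc"
  shows "lin_ext sc A (\<Sum>i\<in>J. x i) w = (\<Sum>i\<in>J. lin_ext sc A (x i) w)"
  by (induction J rule: infinite_finite_induct)
     (simp_all add: lin_ext_zero lin_ext_add[OF assms])

text \<open>
  Both sides of the module identity are bilinear in the two Lie algebra elements, so it suffices to
  know the commutators of the operators attached to the basis.
\<close>

lemma lie_module_lin_ext:
  assumes sc: "vector_space sc"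
    and linear: "\<And>g. g \<in> B \<Longrightarrow> Vector_Spaces.linear sc sc (A g)"
    and bracket: "\<And>a b w. a \<in> B \<Longrightarrow> b \<in> B \<Longrightarrow>
      lin_ext sc A (br a b) w = A a (A b w) - A b (A a w)"
  shows "lie_module B br sc (lin_ext sc A)"
proof -
  interpret vector_space sc by fact
  interpret pair: vector_space_pair sc sc ..
  note hom = linear[unfolded linear_iff_module_hom]
  have lin: "Vector_Spaces.linear sc sc (lin_ext sc A x)" if x: "x \<in> lie_carrier B" for x
    unfolding lin_ext_def
  proof (intro pair.linear_compose_sum ballI pair.linear_compose_scale_right linear)
    show "\<And>g. g \<in> Poly_Mapping.keys x \<Longrightarrow> g \<in> B"
      using x by (auto simp: lie_carrier_def)
  qed
  have product: "lin_ext sc A x (lin_ext sc A y w) =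
      (\<Sum>a\<in>Poly_Mapping.keys x. \<Sum>b\<in>Poly_Mapping.keys y.
        sc (Poly_Mapping.lookup x a * Poly_Mapping.lookup y b) (A a (A b w)))"
    if "x \<in> lie_carrier B" for x y w
  proof -
    have "A a (lin_ext sc A y w) = (\<Sum>b\<in>Poly_Mapping.keys y. sc (Poly_Mapping.lookup y b) (A a (A b w)))"
      if "a \<in> Poly_Mapping.keys x" for a
      using that \<open>x \<in> lie_carrier B\<close>
      by (auto simp: lin_ext_def lie_carrier_def module_hom.sum[OF hom] module_hom.scale[OF hom])
    then show ?thesis
      by (simp add: lin_ext_def[of sc A x] scale_sum_right)
  qed
  have "lin_ext sc A (lie_bracket br x y) w =
      lin_ext sc A x (lin_ext sc A y w) - lin_ext sc A y (lin_ext sc A x w)"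
    if x: "x \<in> lie_carrier B" and y: "y \<in> lie_carrier B" for x y w
  proof -
    have "lin_ext sc A (lie_bracket br x y) w =
      (\<Sum>a\<in>Poly_Mapping.keys x. \<Sum>b\<in>Poly_Mapping.keys y.
        sc (Poly_Mapping.lookup x a * Poly_Mapping.lookup y b) (A a (A b w) - A b (A a w)))"
      unfolding lie_bracket_def lin_ext_sum[OF sc] lin_ext_pscale[OF sc]
      using x y by (intro sum.cong refl arg_cong[where f="sc _"] bracket) (auto simp: lie_carrier_def)
    also have "\<dots> = lin_ext sc A x (lin_ext sc A y w) -
      (\<Sum>a\<in>Poly_Mapping.keys x. \<Sum>b\<in>Poly_Mapping.keys y.
        sc (Poly_Mapping.lookup x a * Poly_Mapping.lookup y b) (A b (A a w)))"
      unfolding product[OF x] scale_right_diff_distrib sum_subtractf ..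
    also have "(\<Sum>a\<in>Poly_Mapping.keys x. \<Sum>b\<in>Poly_Mapping.keys y.
        sc (Poly_Mapping.lookup x a * Poly_Mapping.lookup y b) (A b (A a w))) =
        lin_ext sc A y (lin_ext sc A x w)"
      unfolding product[OF y] by (subst sum.swap) (simp add: mult.commute)
    finally show ?thesis .
  qed
  then show ?thesis
    unfolding lie_module_def using sc lin
    by (simp add: lin_ext_add[OF sc] lin_ext_pscale[OF sc])
qed


section \<open>Twisted modules\<close>

lemma Sum_any_eq_sum:
  assumes "finite A" "\<And>k. k \<notin> A \<Longrightarrow> f k = 0"
  shows "Sum_any f = sum f A"
  by (rule Sum_any.expand_superset) (use assms in auto)

lemma Sum_any_eq_single:
  assumes "\<And>k. k \<noteq> a \<Longrightarrow> f k = 0"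
  shows "Sum_any f = f a"
  using Sum_any_eq_sum[of "{a}" f] assms by simp

lemma twisted_support:
  assumes "twisted_module V vac Y \<sigma> p \<xi> sc YW" "r < p" "v \<in> eigenspace V \<sigma> \<xi> r"
  shows "\<not> int p dvd k + int r \<Longrightarrow> YW v k w = 0" and "\<exists>N. \<forall>k<N. YW v k w = 0"
  using assms(1)[unfolded twisted_module_def, THEN conjunct2, THEN conjunct2, THEN conjunct2,
      THEN conjunct2, THEN conjunct2, THEN conjunct1, THEN spec, THEN mp, OF assms(2),
      THEN bspec, OF assms(3), THEN spec, of w]
  by simp_all

text \<open>
  Taking the residue in \<open>x\<^sub>0\<close> turns the Jacobi identity into Borcherds' commutator formula: for
  \<open>n = 0\<close> the binomials \<open>(x\<^sub>1 - x\<^sub>2)\<^sup>n\<close> are 1, so each sum on the left has one term. The twist is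
  visible in the binomial coefficients, whose upper entries are fractional.
\<close>

lemma twisted_commutator:
  assumes tw: "twisted_module V vac Y \<sigma> p \<xi> sc YW"
    and "r < p" "u \<in> eigenspace V \<sigma> \<xi> r" "v \<in> carrier V" "int p dvd b + int r"
  shows "YW u b (YW v c w) - YW v c (YW u b w) =
    Sum_any (\<lambda>k. sc ((-1) ^ k * ((of_int b / of_nat p + of_nat k) gchoose k))
      (YW (Y u (-1 - int k) v) (c + b + int p * int k + int p) w))"
proof -
  interpret vector_space sc
    using tw by (simp add: twisted_module_def)
  \<comment> \<open>the last conjunct of the definition is the Jacobi identity\<close>
  note jacobi = tw[unfolded twisted_module_def Let_def, THEN conjunct2, THEN conjunct2, THEN conjunct2,
      THEN conjunct2, THEN conjunct2, THEN conjunct2, rule_format, OF assms(2-4),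
      where w = w and a = "-1" and b = b and c = c]
  have "Sum_any (\<lambda>k. sc ((-1) ^ k * (0 gchoose k))
          (YW u (b + int p * int k) (YW v (c - int p * int k) w))) -
        Sum_any (\<lambda>k. sc ((-1) ^ k * (0 gchoose k))
          (YW v (c + int p * int k) (YW u (b - int p * int k) w))) =
    Sum_any (\<lambda>k. sc ((-1) ^ k * ((of_int b / of_nat p + of_nat k) gchoose k))
      (YW (Y u (-1 - int k) v) (c + b + int p * int k + int p) w))"
    using jacobi assms(5) by simp
  then show ?thesis
    by (subst (asm) (1 2) Sum_any_eq_single[where a=0]) (simp_all add: gbinomial_0_left)
qed

text \<open>
  Here \<open>Y u 1 vac\<close> is the coefficient of \<open>x\<close> in \<open>Y(u,x)\<one> = exp(x D) u\<close>, that is, the translate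
  \<open>D u\<close>, and the identity says that \<open>Y\<^sub>W(D u, x)\<close> is the derivative of \<open>Y\<^sub>W(u, x)\<close>. It is a coefficient
  of the Jacobi identity for \<open>u\<close> and the vacuum. The exponent of \<open>x\<^sub>2\<close> is taken to be \<open>-1\<close>: as
  \<open>Y\<^sub>W(\<one>, x\<^sub>2)\<close> is constant and both terms on the left then need a nonzero power of it, they vanish.
  The right-hand side has the two terms \<open>Y\<^sub>W(D u)\<close> and \<open>Y\<^sub>W(u)\<close> only, because of the creation property.
\<close>

lemma twisted_derivative:
  assumes tw: "twisted_module V vac Y \<sigma> p \<xi> sc YW"
    and va: "vertex_algebra V vac Y"
    and "r < p" "u \<in> eigenspace V \<sigma> \<xi> r" "int p dvd b + int r"
  shows "YW (Y u 1 vac) b w = sc (of_int b / of_nat p + 1) (YW u (b + int p) w)"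
proof -
  interpret vector_space sc
    using tw by (simp add: twisted_module_def)
  have u: "u \<in> carrier V"
    using assms(4) by (simp add: eigenspace_def)
  have vac: "vac \<in> carrier V" "YW vac k x = (if k = 0 then x else 0)" for k x
    using va tw by (simp_all add: vertex_algebra_def twisted_module_def)
  have creation: "Y u 0 vac = u" "m < 0 \<Longrightarrow> Y u m vac = \<zero>\<^bsub>V\<^esub>" for m
    using va u by (simp_all add: vertex_algebra_def)
  have YW_0: "YW u k 0 = 0" for k
    using tw u module_hom.zero[of sc sc "YW u k"]
    by (simp add: twisted_module_def module_hom_iff_linear)
  have YW_zero: "YW \<zero>\<^bsub>V\<^esub> k x = 0" for k x
  proof -
    interpret V: Module.module complex_ring V
      using va by (simp add: vertex_algebra_def)
    have "YW (\<zero>\<^bsub>V\<^esub> \<oplus>\<^bsub>V\<^esub> \<zero>\<^bsub>V\<^esub>) k x = YW \<zero>\<^bsub>V\<^esub> k x + YW \<zero>\<^bsub>V\<^esub> k x"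
      by (rule tw[unfolded twisted_module_def, THEN conjunct2, THEN conjunct2, THEN conjunct1,
            rule_format]) simp_all
    then show ?thesis by simp
  qed
  have p: "p > 0"
    using assms(3) by simp
  \<comment> \<open>the last conjunct of the definition is the Jacobi identity\<close>
  note jacobi = tw[unfolded twisted_module_def Let_def, THEN conjunct2, THEN conjunct2, THEN conjunct2,
      THEN conjunct2, THEN conjunct2, THEN conjunct2, rule_format, OF assms(3,4) vac(1),
      where w = w and a = 1 and b = b and c = "- int p"]
  have exponents: "- int p - int p * int k \<noteq> 0" "- int p - int p * - 2 + int p * int k \<noteq> 0" for k
  proof -
    have *: "- int p - int p * int k = - (int p * (1 + int k))"
      "- int p - int p * - 2 + int p * int k = int p * (1 + int k)"
      by (simp_all add: algebra_simps)
    show "- int p - int p * int k \<noteq> 0" "- int p - int p * - 2 + int p * int k \<noteq> 0"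
      unfolding * using p by simp_all
  qed
  have "Sum_any (\<lambda>k. sc ((-1) ^ k * ((of_int b / of_nat p + of_nat k) gchoose k))
      (YW (Y u (1 - int k) vac) (- int p + b + int p * int k + int p) w)) =
    Sum_any (\<lambda>k::nat. sc ((-1) ^ k * (of_int (- 1 - 1) gchoose k))
      (YW u (b - int p * (- 1 - 1) + int p * int k) (YW vac (- int p - int p * int k) w))) -
    Sum_any (\<lambda>k::nat. sc ((-1) powi (- 1 - 1) * (-1) ^ k * (of_int (- 1 - 1) gchoose k))
      (YW vac (- int p - int p * (- 1 - 1) + int p * int k) (YW u (b - int p * int k) w)))"
    using jacobi assms(5) by (simp only: if_True)
  also have "\<dots> = 0"
    using exponents by (simp add: vac YW_0)
  finally have sum_eq_0: "Sum_any (\<lambda>k. sc ((-1) ^ k * ((of_int b / of_nat p + of_nat k) gchoose k))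
      (YW (Y u (1 - int k) vac) (- int p + b + int p * int k + int p) w)) = 0" .
  have sum_eq: "Sum_any (\<lambda>k. sc ((-1) ^ k * ((of_int b / of_nat p + of_nat k) gchoose k))
      (YW (Y u (1 - int k) vac) (- int p + b + int p * int k + int p) w)) =
    (\<Sum>k\<in>{0, 1}. sc ((-1) ^ k * ((of_int b / of_nat p + of_nat k) gchoose k))
      (YW (Y u (1 - int k) vac) (- int p + b + int p * int k + int p) w))"
  proof (rule Sum_any_eq_sum)
    fix k :: nat assume "k \<notin> {0, 1}"
    then have "Y u (1 - int k) vac = \<zero>\<^bsub>V\<^esub>"
      by (intro creation) auto
    then show "sc ((-1) ^ k * ((of_int b / of_nat p + of_nat k) gchoose k))
        (YW (Y u (1 - int k) vac) (- int p + b + int p * int k + int p) w) = 0"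
      by (simp only: YW_zero scale_zero_right)
  qed simp
  have "(\<Sum>k\<in>{0, 1}. sc ((-1) ^ k * ((of_int b / of_nat p + of_nat k) gchoose k))
      (YW (Y u (1 - int k) vac) (- int p + b + int p * int k + int p) w)) = 0"
    by (rule trans[OF sum_eq[symmetric] sum_eq_0])
  then have "YW (Y u 1 vac) b w + sc (- (of_int b / of_nat p + 1)) (YW u (b + int p) w) = 0"
    by (simp add: creation(1) gbinomial_1[unfolded One_nat_def] del: scale_minus_left)
  then show ?thesis
    by (simp only: scale_minus_left eq_neg_iff_add_eq_0[symmetric] minus_minus)
qed

section \<open>The vacuum module of \<open>\<N>\<^sub>p\<close>\<close>

lemma fold_index_le: "i \<le> p - 1 \<Longrightarrow> fold_index p i \<le> p div 2"
  by (auto simp: fold_index_def)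

interpretation np: induced "np_basis p" "np_br p" "np_sub p" "np_char l" for p l
proof
  show "np_sub p \<subseteq> np_basis p"
    by (auto simp: np_sub_def np_basis_def)
  fix a b assume "a \<in> np_basis p" "b \<in> np_basis p"
  then have "np_br p a b \<in> lie_carrier (np_basis p)"
    by (cases a; cases b)
       (auto simp: np_basis_def lie_carrier_def fold_index_le pscale_def
         dest!: subsetD[OF keys_add] subsetD[OF keys_pscale_subset[unfolded pscale_def]])
  then show "Poly_Mapping.keys (np_br p a b) \<subseteq> np_basis p"
    by (simp add: lie_carrier_def)
qed

lemma np_vac_in_carrier: "np_vac p l \<in> carrier (V_np p l)"
  unfolding V_np_def np_vac_def by (rule np.cls_in_carrier) simp

lemma np_act_vac: "g \<in> np_basis p \<Longrightarrow> np_act p l g (np_vac p l) =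
    cls (ind_rel (np_basis p) (np_br p) (np_sub p) (np_char l)) (iota (bas g))"
  unfolding np_act_def np_vac_def by (simp add: np.act_cls)

lemma np_act_vac_in_carrier:
  "g \<in> np_basis p \<Longrightarrow> np_act p l g (np_vac p l) \<in> carrier (V_np p l)"
  unfolding V_np_def by (simp add: np_act_vac np.cls_in_carrier)

lemma T_in_np_basis: "T m \<in> np_basis p"
  by (simp add: np_basis_def)

lemma N_in_np_basis: "i \<in> {1..p-1} \<Longrightarrow> N i m \<in> np_basis p"
  by (simp add: np_basis_def)

text \<open>
  The nonnegative products of the generators of the vertex algebra. In physics notation they are the
  singular parts of the operator products: \<open>T T\<close> has poles of order 4, 2 and 1, \<open>T N\<^sup>i\<close> of order 2
  and 1, and \<open>N\<^sup>i N\<^sup>j\<close> of order 2.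
\<close>

lemma np_act_T_T:
  assumes "k \<ge> -1"
  shows "np_act p l (T k) (np_act p l (T (-2)) (np_vac p l)) =
    (if k = -1 then np_act p l (T (-3)) (np_vac p l)
     else if k = 0 then 2 \<odot>\<^bsub>V_np p l\<^esub> np_act p l (T (-2)) (np_vac p l)
     else if k = 2 then (l 0 / 2) \<odot>\<^bsub>V_np p l\<^esub> np_vac p l
     else 0 \<odot>\<^bsub>V_np p l\<^esub> np_vac p l)"
proof -
  have S: "T k \<in> np_sub p" "T (-2) \<in> np_basis p" "T (-3) \<in> np_basis p"
    using assms by (simp_all add: np_sub_def np_basis_def)
  consider "k = -1" | "k = 0" | "k \<ge> 1"
    using assms by linarith
  then show ?thesis
  proof cases
    case 1
    then show ?thesis
      unfolding np_act_def np_vac_def V_np_def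
      using np.act_act_vacuum_scale[of "T k" p l "T (-2)" 1 "T (-3)"] S
      by (simp add: np.act_cls np.smult_cls)
  next
    case 2
    then show ?thesis
      unfolding np_act_def np_vac_def V_np_def
      using np.act_act_vacuum_scale[of "T k" p l "T (-2)" 2 "T (-2)"] S by simp
  next
    case 3
    then have br: "np_br p (T k) (T (-2)) = pscale (of_int (k + 2)) (bas (T (k - 2))) +
        (if k = 2 then pscale (1 / 2) (bas (K 0)) else 0)"
      by simp
    have "np_br p (T k) (T (-2)) \<in> lie_carrier (np_sub p)"
      unfolding br using 3
      by (intro lie_carrier_add lie_carrier_pscale)
         (simp_all add: np_sub_def lie_carrier_pscale, simp add: lie_carrier_def)
    moreover have "char_ext (np_char l) (iota (np_br p (T k) (T (-2)))) =
        (if k = 2 then l 0 / 2 else 0)"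
      unfolding br
      by (simp add: iota_add iota_pscale char_ext_add char_ext_pscale char_ext_iota_bas)
    ultimately show ?thesis
      unfolding np_act_def np_vac_def V_np_def
      using np.act_act_vacuum_character[of "T k" p l "T (-2)"] S 3 by simp
  qed
qed

lemma np_act_T_N:
  assumes "k \<ge> -1" "i \<in> {1..p-1}"
  shows "np_act p l (T k) (np_act p l (N i (-1)) (np_vac p l)) =
    (if k = -1 then np_act p l (N i (-2)) (np_vac p l)
     else if k = 0 then np_act p l (N i (-1)) (np_vac p l)
     else 0 \<odot>\<^bsub>V_np p l\<^esub> np_vac p l)"
proof -
  have S: "T k \<in> np_sub p" "N i m \<in> np_basis p" for m
    using assms by (simp_all add: np_sub_def np_basis_def)
  show ?thesis
  proof (cases "k \<le> 0")
    case True
    then have "k = -1 \<or> k = 0"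
      using assms(1) by linarith
    then show ?thesis
      unfolding np_act_def np_vac_def V_np_def
      using np.act_act_vacuum_scale[of "T k" p l "N i (-1)" 1 "N i (k - 1)"] S
      by (auto simp: np.act_cls np.smult_cls)
  next
    case False
    then have "np_br p (T k) (N i (-1)) \<in> lie_carrier (np_sub p)"
      using assms(2) by (simp add: np_sub_def)
    moreover have "char_ext (np_char l) (iota (np_br p (T k) (N i (-1)))) = 0"
      by (simp add: char_ext_iota_bas)
    ultimately show ?thesis
      unfolding np_act_def np_vac_def V_np_def
      using np.act_act_vacuum_character[of "T k" p l "N i (-1)"] S False by simp
  qed
qed

lemma np_act_N_N:
  assumes "k \<ge> 0" "i \<in> {1..p-1}" "j \<in> {1..p-1}"
  shows "np_act p l (N i k) (np_act p l (N j (-1)) (np_vac p l)) =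
    (if i + j = p \<and> k = 1 then l (fold_index p i) else 0) \<odot>\<^bsub>V_np p l\<^esub> np_vac p l"
proof -
  have S: "N i k \<in> np_sub p" "N j (-1) \<in> np_basis p"
    using assms by (simp_all add: np_sub_def np_basis_def)
  have "np_br p (N i k) (N j (-1)) \<in> lie_carrier (np_sub p)"
    using assms(2) fold_index_le[of i p] by (auto simp: np_sub_def lie_carrier_def in_keys_iff lookup_bas)
  moreover have "char_ext (np_char l) (iota (np_br p (N i k) (N j (-1)))) =
      (if i + j = p \<and> k = 1 then l (fold_index p i) else 0)"
    by (simp add: iota_pscale char_ext_pscale char_ext_iota_bas)
  ultimately show ?thesis
    unfolding np_act_def np_vac_def V_np_def
    using np.act_act_vacuum_character[of "N i k" p l "N j (-1)"] S by simp
qed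

lemma rescale_lie_bas: "rescale_lie \<epsilon> (bas g) = pscale (\<epsilon> g) (bas g)"
  by (rule poly_mapping_eqI) (simp add: lookup_bas)

text \<open>
  The one bracket that could violate the grading is \<open>[N\<^sup>i, N\<^sup>j]\<close>, which is central and nonzero only for
  \<open>i + j = p\<close>, where \<open>\<xi>\<^sup>i \<xi>\<^sup>j = 1\<close>.
\<close>

lemma sigma_eigenvalue_bracket:
  assumes "\<xi> ^ p = 1" and "a \<in> np_basis p" "b \<in> np_basis p" "g \<in> Poly_Mapping.keys (np_br p a b)"
  shows "sigma_eigenvalue \<xi> g = sigma_eigenvalue \<xi> a * sigma_eigenvalue \<xi> b"
proof -
  have "Poly_Mapping.lookup (np_br p a b) g \<noteq> 0"
    using assms(4) by (simp add: in_keys_iff)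
  then show ?thesis
    using assms(1)
    by (cases a; cases b)
       (auto simp: lookup_add lookup_bas power_add[symmetric] split: if_splits)
qed

lemma np_act_vac_eigenspace:
  assumes "\<xi> ^ p = 1" "\<xi> \<noteq> 0" "g \<in> np_basis p" "sigma_eigenvalue \<xi> g = \<xi> ^ r"
  shows "np_act p l g (np_vac p l) \<in> eigenspace (V_np p l) (sigma_np \<xi>) \<xi> r"
proof -
  have "sigma_free \<xi> = rescale (sigma_eigenvalue \<xi>)"
    by (simp add: sigma_free_def rescale_def)
  moreover have "rescale (sigma_eigenvalue \<xi>) `
        cls (ind_rel (np_basis p) (np_br p) (np_sub p) (np_char l)) f =
      cls (ind_rel (np_basis p) (np_br p) (np_sub p) (np_char l)) (rescale (sigma_eigenvalue \<xi>) f)" for f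
  proof (rule np.rescale_cls)
    show "sigma_eigenvalue \<xi> h \<noteq> 0" for h
      using assms(2) by (cases h) auto
    show "sigma_eigenvalue \<xi> h * np_char l h = np_char l h" for h
      by (cases h) auto
  qed (rule sigma_eigenvalue_bracket[OF assms(1)])
  ultimately have "sigma_np \<xi> (np_act p l g (np_vac p l)) =
      sigma_eigenvalue \<xi> g \<odot>\<^bsub>V_np p l\<^esub> np_act p l g (np_vac p l)"
    using assms(3)
    by (simp add: sigma_np_def np_act_vac rescale_iota rescale_lie_bas iota_pscale np.smult_cls V_np_def)
  then show ?thesis
    using assms(3,4) by (simp add: eigenspace_def np_act_vac_in_carrier)
qed

lemma gbinomial_3: "(a::complex) gchoose 3 = a * (a - 1) * (a - 2) / 6"
  by (simp add: gbinomial_prod_rev numeral_3_eq_3 atLeast0_lessThan_Suc fact_numeral)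

section \<open>The action of the gap-\<open>p\<close> Virasoro algebra\<close>

text \<open>
  With \<open>\<sigma>\<close> scaling \<open>N\<^sup>i\<close> by \<open>\<xi>\<^sup>i\<close>, all central elements are fixed and an arbitrary level \<open>l\<close> is
  compatible with the automorphism; the commutators are computed at this generality, where the
  central terms of \<open>[I\<^sup>i, I\<^sup>j]\<close> are visible.
\<close>

locale twisted_np_module =
  fixes p :: nat and l :: "nat \<Rightarrow> complex" and \<xi> :: complex
    and Y :: "np_elt \<Rightarrow> int \<Rightarrow> np_elt \<Rightarrow> np_elt"
    and sc :: "complex \<Rightarrow> 'w::ab_group_add \<Rightarrow> 'w"
    and YW :: "np_elt \<Rightarrow> int \<Rightarrow> 'w \<Rightarrow> 'w"
  assumes p_pos: "p > 0" and root: "\<xi> ^ p = 1"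
    and vertex_structure: "np_vertex_structure p l Y"
    and twisted: "twisted_module (V_np p l) (np_vac p l) Y (sigma_np \<xi>) p \<xi> sc YW"
begin

abbreviation "V \<equiv> V_np p l"
abbreviation "vac \<equiv> np_vac p l"
abbreviation "conf \<equiv> np_act p l (T (-2)) vac"
abbreviation "heis i \<equiv> np_act p l (N i (-1)) vac"

text \<open>
  The coefficients of \<open>x\<^sup>-\<^sup>n\<^sup>-\<^sup>2\<close> and \<open>x\<^sup>-\<^sup>n\<^sup>-\<^sup>1\<^sup>-\<^sup>i\<^sup>/\<^sup>p\<close>; exponents are counted in units of \<open>1/p\<close>.
\<close>

definition gap_op :: "gap_gen \<Rightarrow> 'w \<Rightarrow> 'w" where
  "gap_op g = (case g of
     L n \<Rightarrow> YW conf (int p * (- n - 2))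
   | I i n \<Rightarrow> YW (heis i) (int p * (- n - 1) - int i)
   | C j \<Rightarrow> sc (l j))"

sublocale vector_space sc
  using twisted by (simp add: twisted_module_def)

lemma Y_conf: "v \<in> carrier V \<Longrightarrow> Y conf m v = np_act p l (T (- m - 2)) v"
  using vertex_structure by (simp add: np_vertex_structure_def)

lemma Y_heis: "i \<in> {1..p-1} \<Longrightarrow> v \<in> carrier V \<Longrightarrow> Y (heis i) m v = np_act p l (N i (- m - 1)) v"
  using vertex_structure by (simp add: np_vertex_structure_def)

lemma vertex_algebra: "vertex_algebra V vac Y"
  using vertex_structure by (simp add: np_vertex_structure_def)

lemma YW_linear: "v \<in> carrier V \<Longrightarrow> Vector_Spaces.linear sc sc (YW v k)"
  using twisted by (simp add: twisted_module_def)

lemma YW_smult: "v \<in> carrier V \<Longrightarrow> YW (c \<odot>\<^bsub>V\<^esub> v) k w = sc c (YW v k w)"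
  using twisted by (simp add: twisted_module_def)

lemma YW_vac: "YW vac k w = (if k = 0 then w else 0)"
  using twisted by (simp add: twisted_module_def)

lemma conf_in_carrier: "conf \<in> carrier V"
  by (rule np_act_vac_in_carrier[OF T_in_np_basis])

lemma heis_in_carrier: "i \<in> {1..p-1} \<Longrightarrow> heis i \<in> carrier V"
  by (rule np_act_vac_in_carrier[OF N_in_np_basis])

lemma \<xi>_nonzero: "\<xi> \<noteq> 0"
  using root p_pos by (auto simp: power_0_left)

lemma conf_eigenspace: "conf \<in> eigenspace V (sigma_np \<xi>) \<xi> 0"
  by (rule np_act_vac_eigenspace[OF root \<xi>_nonzero T_in_np_basis]) simp

lemma heis_eigenspace: "i \<in> {1..p-1} \<Longrightarrow> heis i \<in> eigenspace V (sigma_np \<xi>) \<xi> i"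
  by (rule np_act_vac_eigenspace[OF root \<xi>_nonzero N_in_np_basis]) simp_all

lemma heis_index_less: "i \<in> {1..p-1} \<Longrightarrow> i < p"
  by auto

text \<open>
  The vectors \<open>T\<^sub>-\<^sub>3\<one>\<close> and \<open>N\<^sup>i\<^sub>-\<^sub>2\<one>\<close> are the translates of the generators, and the simple poles of
  the operator products produce them. Differentiation brings their modes back to modes of the
  generators.
\<close>

lemma YW_T3: "YW (np_act p l (T (-3)) vac) (int p * (k - 1)) w =
    sc (of_int k) (YW conf (int p * k) w)"
proof -
  have exponent: "int p * (k - 1) + int p = int p * k"
    by (simp add: right_diff_distrib)
  have coefficient: "of_int (int p * (k - 1)) / of_nat p + 1 = (of_int k :: complex)"
    using p_pos by (simp add: field_simps)
  show ?thesis
    using twisted_derivative[OF twisted vertex_algebra p_pos conf_eigenspace,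
        of "int p * (k - 1)" w, unfolded exponent coefficient] np_vac_in_carrier[of p l]
    by (simp add: Y_conf)
qed

lemma YW_N2:
  assumes "i \<in> {1..p-1}"
  shows "YW (np_act p l (N i (-2)) vac) (int p * (k - 1) - int i) w =
    sc (of_int k - of_nat i / of_nat p) (YW (heis i) (int p * k - int i) w)"
proof -
  have exponent: "int p * (k - 1) - int i + int p = int p * k - int i"
    by (simp add: right_diff_distrib)
  have coefficient: "of_int (int p * (k - 1) - int i) / of_nat p + 1 =
      (of_int k - of_nat i / of_nat p :: complex)"
    using p_pos by (simp add: field_simps)
  show ?thesis
    using twisted_derivative[OF twisted vertex_algebra heis_index_less[OF assms]
        heis_eigenspace[OF assms], of "int p * (k - 1) - int i" w, unfolded exponent coefficient]
      np_vac_in_carrier[of p l] Y_heis[OF assms]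
    by simp
qed

lemma mode_T_conf:
  "Y conf (-1 - int k) conf =
    (if k = 0 then np_act p l (T (-3)) vac
     else if k = 1 then 2 \<odot>\<^bsub>V\<^esub> conf
     else if k = 3 then (l 0 / 2) \<odot>\<^bsub>V\<^esub> vac
     else 0 \<odot>\<^bsub>V\<^esub> vac)"
  using np_act_T_T[of "int k - 1" p l] by (auto simp: Y_conf conf_in_carrier)

lemma mode_T_heis:
  "i \<in> {1..p-1} \<Longrightarrow> Y conf (-1 - int k) (heis i) =
    (if k = 0 then np_act p l (N i (-2)) vac
     else if k = 1 then heis i
     else 0 \<odot>\<^bsub>V\<^esub> vac)"
  using np_act_T_N[of "int k - 1" i p l] by (auto simp: Y_conf heis_in_carrier)

lemma mode_heis_heis:
  "i \<in> {1..p-1} \<Longrightarrow> j \<in> {1..p-1} \<Longrightarrow> Y (heis i) (-1 - int k) (heis j) =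
    (if i + j = p \<and> k = 1 then l (fold_index p i) else 0) \<odot>\<^bsub>V\<^esub> vac"
  using np_act_N_N[of "int k" i p j l] by (simp add: Y_heis heis_in_carrier)

lemmas gap_op_simps [simp] = gap_op_def[of "L _", simplified] gap_op_def[of "I _ _", simplified]
  gap_op_def[of "C _", simplified]

lemma gap_op_linear:
  assumes "g \<in> gap_basis p"
  shows "Vector_Spaces.linear sc sc (gap_op g)"
  using assms by (auto simp: gap_basis_def YW_linear conf_in_carrier heis_in_carrier linear_scale_self)

text \<open>
  The simple and double pole contribute \<open>-(m+n+2) L(m+n)\<close> and \<open>2(m+1) L(m+n)\<close>; the pole of order 4
  contributes, for \<open>m + n = 0\<close>, \<open>-(l\<^sub>0/2)\<close> times the binomial coefficient of \<open>1-m\<close> over 3, which is \<open>(m-m\<^sup>3)/6\<close>.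
\<close>

lemma commutator_L_L:
  "gap_op (L m) (gap_op (L n) w) - gap_op (L n) (gap_op (L m) w) =
    lin_ext sc gap_op (gap_br p (L m) (L n)) w"
proof -
  let ?x = "of_int (- m - 2) :: complex"
  let ?f = "\<lambda>k. sc ((-1) ^ k * ((?x + of_nat k) gchoose k))
    (YW (Y conf (-1 - int k) conf) (int p * (int k - m - n - 3)) w)"
  have quotient: "of_int (int p * (- m - 2)) / of_nat p = ?x"
    using p_pos by simp
  have exponent_1: "int p * (int 1 - m - n - 3) = int p * (- (m + n) - 2)"
    by simp
  have exponent_3: "int p * (int 3 - m - n - 3) = int p * - (m + n)"
    by simp
  have central_term: "(-1) ^ 3 * ((?x + of_nat 3) gchoose 3) * (l 0 / 2) =
      of_int (m ^ 3 - m) / 12 * l 0"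
    by (simp add: gbinomial_3 field_simps power3_eq_cube)
  have exponent: "int p * (- n - 2) + int p * (- m - 2) + int p * int k + int p =
      int p * (int k - m - n - 3)" for k
    by (simp add: algebra_simps)
  have "gap_op (L m) (gap_op (L n) w) - gap_op (L n) (gap_op (L m) w) = Sum_any ?f"
    using twisted_commutator[OF twisted p_pos conf_eigenspace conf_in_carrier, of
        "int p * (- m - 2)" "int p * (- n - 2)" w, unfolded quotient exponent] by simp
  also have "\<dots> = sum ?f {0, 1, 3}"
  proof (rule Sum_any_eq_sum)
    show "?f k = 0" if "k \<notin> {0, 1, 3}" for k
      using that by (simp add: mode_T_conf YW_smult np_vac_in_carrier)
  qed simp
  also have "\<dots> = ?f 0 + (?f 1 + ?f 3)"
    by simp
  also have "?f 0 = YW (np_act p l (T (-3)) vac) (int p * (- (m + n) - 2 - 1)) w"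
    by (simp add: mode_T_conf[of 0, simplified] algebra_simps)
  also have "\<dots> = sc (of_int (- m - n - 2)) (gap_op (L (m + n)) w)"
    unfolding YW_T3 by simp
  also have "?f 1 = sc (2 * of_int (m + 1)) (gap_op (L (m + n)) w)"
    unfolding exponent_1
    by (simp add: mode_T_conf[of 1, simplified] YW_smult conf_in_carrier algebra_simps)
  also have "?f 3 = sc ((-1) ^ 3 * ((?x + of_nat 3) gchoose 3) * (l 0 / 2))
      (YW vac (int p * - (m + n)) w)"
    unfolding exponent_3 by (simp add: mode_T_conf[of 3, simplified] YW_smult np_vac_in_carrier)
  also have "\<dots> = (if m + n = 0 then sc (of_int (m ^ 3 - m) / 12) (sc (l 0) w) else 0)"
    unfolding central_term using p_pos by (simp add: YW_vac)
  finally have "gap_op (L m) (gap_op (L n) w) - gap_op (L n) (gap_op (L m) w) =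
      (sc (of_int (- m - n - 2)) (gap_op (L (m + n)) w) +
        sc (2 * of_int (m + 1)) (gap_op (L (m + n)) w)) +
      (if m + n = 0 then sc (of_int (m ^ 3 - m) / 12) (sc (l 0) w) else 0)"
    by (simp only: add.assoc)
  also have "sc (of_int (- m - n - 2)) (gap_op (L (m + n)) w) +
        sc (2 * of_int (m + 1)) (gap_op (L (m + n)) w) =
      sc (of_int (m - n)) (gap_op (L (m + n)) w)"
    unfolding scale_left_distrib[symmetric] by (rule arg_cong[where f = "\<lambda>c. sc c _"]) simp
  finally show ?thesis
    by (simp del: scale_scale
        add: lin_ext_add[OF vector_space_axioms] lin_ext_pscale[OF vector_space_axioms]
        lin_ext_bas[OF vector_space_axioms] lin_ext_zero)
qed

text \<open>
  The shift of \<open>n\<close> to \<open>n + i/p\<close> in the bracket comes from differentiating the fractional power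
  \<open>x\<^sup>-\<^sup>n\<^sup>-\<^sup>1\<^sup>-\<^sup>i\<^sup>/\<^sup>p\<close>.
\<close>

lemma commutator_L_I:
  assumes i: "i \<in> {1..p-1}"
  shows "gap_op (L m) (gap_op (I i n) w) - gap_op (I i n) (gap_op (L m) w) =
    lin_ext sc gap_op (gap_br p (L m) (I i n)) w"
proof -
  let ?x = "of_int (- m - 2) :: complex"
  let ?f = "\<lambda>k. sc ((-1) ^ k * ((?x + of_nat k) gchoose k))
    (YW (Y conf (-1 - int k) (heis i)) (int p * (int k - m - n - 2) - int i) w)"
  have quotient: "of_int (int p * (- m - 2)) / of_nat p = ?x"
    using p_pos by simp
  have exponent_1: "int p * (int 1 - m - n - 2) - int i = int p * (- (m + n) - 1) - int i"
    by simp
  have exponent: "int p * (- n - 1) - int i + int p * (- m - 2) + int p * int k + int p =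
      int p * (int k - m - n - 2) - int i" for k
    by (simp add: algebra_simps)
  have "gap_op (L m) (gap_op (I i n) w) - gap_op (I i n) (gap_op (L m) w) = Sum_any ?f"
    using twisted_commutator[OF twisted p_pos conf_eigenspace heis_in_carrier[OF i], of
        "int p * (- m - 2)" "int p * (- n - 1) - int i" w, unfolded quotient exponent] by simp
  also have "\<dots> = sum ?f {0, 1}"
  proof (rule Sum_any_eq_sum)
    show "?f k = 0" if "k \<notin> {0, 1}" for k
      using that by (simp add: mode_T_heis[OF i] YW_smult np_vac_in_carrier)
  qed simp
  also have "\<dots> = ?f 0 + ?f 1"
    by simp
  also have "?f 0 = YW (np_act p l (N i (-2)) vac) (int p * (- (m + n) - 1 - 1) - int i) w"
    by (simp add: mode_T_heis[OF i, of 0, simplified] algebra_simps)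
  also have "\<dots> = sc (of_int (- m - n - 1) - of_nat i / of_nat p) (gap_op (I i (m + n)) w)"
    unfolding YW_N2[OF i] by simp
  also have "?f 1 = sc (of_int (m + 1)) (gap_op (I i (m + n)) w)"
    unfolding exponent_1 by (simp add: mode_T_heis[OF i, of 1, simplified] algebra_simps)
  also have "sc (of_int (- m - n - 1) - of_nat i / of_nat p) (gap_op (I i (m + n)) w) +
      sc (of_int (m + 1)) (gap_op (I i (m + n)) w) =
      sc (- (of_int n + of_nat i / of_nat p)) (gap_op (I i (m + n)) w)"
    unfolding scale_left_distrib[symmetric] by (rule arg_cong[where f = "\<lambda>c. sc c _"]) simp
  finally show ?thesis
    by (simp del: scale_minus_left add: lin_ext_pscale[OF vector_space_axioms]
        lin_ext_bas[OF vector_space_axioms])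
qed

text \<open>
  Here the shift of \<open>m\<close> to \<open>m + i/p\<close> is the fractional entry of the binomial coefficient. The constant
  series \<open>Y\<^sub>W(\<one>, x)\<close> selects the total exponent 0. As \<open>i/p + j/p = 1\<close>, this means \<open>m + n + 1 = 0\<close>, in
  contrast to \<open>m + n = 0\<close> for \<open>\<N>\<^sub>p\<close>.
\<close>

lemma commutator_I_I:
  assumes i: "i \<in> {1..p-1}" and j: "j \<in> {1..p-1}"
  shows "gap_op (I i m) (gap_op (I j n) w) - gap_op (I j n) (gap_op (I i m) w) =
    lin_ext sc gap_op (gap_br p (I i m) (I j n)) w"
proof -
  let ?b = "int p * (- m - 1) - int i"
  let ?f = "\<lambda>k. sc ((-1) ^ k * ((of_int ?b / of_nat p + of_nat k) gchoose k))
    (YW (Y (heis i) (-1 - int k) (heis j)) (int p * (int k - m - n - 1) - int i - int j) w)"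
  have exponent: "int p * (- n - 1) - int j + ?b + int p * int k + int p =
      int p * (int k - m - n - 1) - int i - int j" for k
    by (simp add: algebra_simps)
  have "gap_op (I i m) (gap_op (I j n) w) - gap_op (I j n) (gap_op (I i m) w) = Sum_any ?f"
    using twisted_commutator[OF twisted heis_index_less[OF i] heis_eigenspace[OF i] heis_in_carrier[OF j], of
        ?b "int p * (- n - 1) - int j" w, unfolded exponent] by simp
  also have "\<dots> = ?f 1"
    by (rule Sum_any_eq_single) (simp add: mode_heis_heis[OF i j] YW_smult np_vac_in_carrier)
  also have "\<dots> = lin_ext sc gap_op (gap_br p (I i m) (I j n)) w"
  proof (cases "i + j = p")
    case True
    then have exponent: "int p * (int 1 - m - n - 1) - int i - int j = int p * (- (m + n + 1))"
      by (simp add: algebra_simps)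
    have coefficient: "- (of_int ?b / of_nat p + 1) = (of_int m + of_nat i / of_nat p :: complex)"
      using p_pos by (simp add: field_simps)
    have "?f 1 = sc (- (of_int ?b / of_nat p + 1))
        (sc (l (fold_index p i)) (YW vac (int p * (- (m + n + 1))) w))"
      unfolding exponent using True
      by (simp add: mode_heis_heis[OF i j, of 1, simplified] YW_smult np_vac_in_carrier
          del: scale_minus_left scale_scale of_int_diff)
    then show ?thesis
      unfolding coefficient using True p_pos
      by (simp add: YW_vac lin_ext_pscale[OF vector_space_axioms]
        lin_ext_bas[OF vector_space_axioms] lin_ext_zero)
  next
    case False
    then show ?thesis
      by (simp add: mode_heis_heis[OF i j, of 1, simplified] YW_smult np_vac_in_carrier lin_ext_zero)
  qed
  finally show ?thesis .
qed

lemma lin_ext_gap_br: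
  assumes "a \<in> gap_basis p" "b \<in> gap_basis p"
  shows "lin_ext sc gap_op (gap_br p a b) w = gap_op a (gap_op b w) - gap_op b (gap_op a w)"
proof -
  have central: "gap_op g (sc c x) = sc c (gap_op g x)" if "g \<in> gap_basis p" for g c x
    using module_hom.scale[OF gap_op_linear[OF that, unfolded linear_iff_module_hom]] .
  have swap: "lin_ext sc gap_op (gap_br p (I i n) (L m)) w =
      - lin_ext sc gap_op (gap_br p (L m) (I i n)) w" for i m n
    by (simp only: gap_br.simps lin_ext_pscale[OF vector_space_axioms] scale_minus_left minus_minus)
  show ?thesis
  proof (cases a)
    case a: (L m)
    show ?thesis
    proof (cases b)
      case (L n)
      then show ?thesis unfolding a by (simp only: commutator_L_L)
    next
      case (I i n)
      then show ?thesis unfolding a using assms(2)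
        by (simp add: commutator_L_I gap_basis_def del: gap_op_simps gap_br.simps)
    next
      case (C j)
      then show ?thesis using central[OF assms(1)] a by (simp add: lin_ext_zero)
    qed
  next
    case a: (I i m)
    then have i: "i \<in> {1..p-1}"
      using assms(1) by (simp add: gap_basis_def)
    show ?thesis
    proof (cases b)
      case (L n)
      then show ?thesis unfolding a by (simp only: swap commutator_L_I[OF i, symmetric] minus_diff_eq)
    next
      case (I j n)
      then show ?thesis unfolding a using assms(2)
        by (simp add: commutator_I_I[OF i] gap_basis_def del: gap_op_simps gap_br.simps)
    next
      case (C j)
      then show ?thesis using central[OF assms(1)] a by (simp add: lin_ext_zero)
    qed
  next
    case (C j)
    then show ?thesis using central[OF assms(2)] by (simp add: lin_ext_zero)
  qed
qed

lemma gap_module_lin_ext: "gap_module p sc (lin_ext sc gap_op)"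
  unfolding gap_module_def
  by (rule lie_module_lin_ext[OF vector_space_axioms gap_op_linear lin_ext_gap_br])

lemma restricted_lin_ext: "restricted p (lin_ext sc gap_op)"
  unfolding restricted_def lin_ext_bas[OF vector_space_axioms]
proof
  fix w
  have eventually_zero: "\<exists>M. \<forall>n\<ge>M. YW v (int p * (- n - s) - int r) w = 0"
    if v: "v \<in> eigenspace V (sigma_np \<xi>) \<xi> r" "r < p" for v r s
  proof -
    obtain N where N: "\<And>k. k < N \<Longrightarrow> YW v k w = 0"
      using twisted_support(2)[OF twisted v(2,1), of w] by blast
    have "int p * (- n - s) - int r < N" if "n \<ge> \<bar>N\<bar> + \<bar>s\<bar> + 1" for n
    proof -
      have pos: "n + s > - N" "n + s \<ge> 0"
        using that by linarith+
      then have "int p * (n + s) \<ge> 1 * (n + s)"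
        using p_pos by (intro mult_right_mono) auto
      moreover have "int p * (- n - s) - int r = - (int p * (n + s)) - int r"
        by (simp add: algebra_simps)
      ultimately show ?thesis
        using pos(1) by simp
    qed
    then show ?thesis
      using N by blast
  qed
  \<comment> \<open>Each of the finitely many generating series has its own bound; their maximum serves all.\<close>
  obtain M0 where M0: "\<And>n. n \<ge> M0 \<Longrightarrow> gap_op (L n) w = 0"
    using eventually_zero[OF conf_eigenspace p_pos, of 2] by auto
  have "\<exists>M. \<forall>n\<ge>M. gap_op (I i n) w = 0" if i: "i \<in> {1..p-1}" for i
    using eventually_zero[OF heis_eigenspace[OF i] heis_index_less[OF i], of 1] by simp
  then obtain M where M: "\<And>i n. i \<in> {1..p-1} \<Longrightarrow> n \<ge> M i \<Longrightarrow> gap_op (I i n) w = 0"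
    by metis
  have "gap_op (L n) w = 0 \<and> (\<forall>i\<in>{1..p-1}. gap_op (I i n) w = 0)"
    if n: "n \<ge> Max (insert M0 (M ` {1..p-1}))" for n
  proof -
    have "n \<ge> M0" "\<And>i. i \<in> {1..p-1} \<Longrightarrow> n \<ge> M i"
      using n by auto
    then show ?thesis
      using M0 M by blast
  qed
  then show "\<exists>N. \<forall>n\<ge>N. gap_op (L n) w = 0 \<and> (\<forall>i\<in>{1..p-1}. gap_op (I i n) w = 0)"
    by blast
qed

lemma has_level_lin_ext: "has_level p sc (lin_ext sc gap_op) l"
  by (simp add: has_level_def lin_ext_bas[OF vector_space_axioms])

lemma L_series_lin_ext: "L_series p (lin_ext sc gap_op) = YW conf"
proof (intro ext)
  fix k w
  show "L_series p (lin_ext sc gap_op) k w = YW conf k w"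
    using twisted_support(1)[OF twisted p_pos conf_eigenspace, of k w]
    by (auto simp: L_series_def lin_ext_bas[OF vector_space_axioms])
qed

lemma I_series_lin_ext:
  assumes i: "i \<in> {1..p-1}"
  shows "I_series p (lin_ext sc gap_op) i = YW (heis i)"
proof (intro ext)
  fix k w
  show "I_series p (lin_ext sc gap_op) i k w = YW (heis i) k w"
    using twisted_support(1)[OF twisted heis_index_less[OF i] heis_eigenspace[OF i], of k w]
    by (auto simp: I_series_def lin_ext_bas[OF vector_space_axioms])
qed

end

theorem theorem2p6:
  fixes p :: nat and l0 \<xi> :: complex
    and Y :: "np_elt \<Rightarrow> int \<Rightarrow> np_elt \<Rightarrow> np_elt"
    and scaleW :: "complex \<Rightarrow> 'w::ab_group_add \<Rightarrow> 'w"
    and YW :: "np_elt \<Rightarrow> int \<Rightarrow> 'w \<Rightarrow> 'w"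
  assumes "p \<ge> 2"
    and "primitive_root p \<xi>"
    and "np_vertex_structure p (level0 l0) Y"
    and "twisted_module (V_np p (level0 l0)) (np_vac p (level0 l0)) Y (sigma_np \<xi>) p \<xi> scaleW YW"
  shows "\<exists>\<rho>. gap_module p scaleW \<rho> \<and> restricted p \<rho> \<and> has_level p scaleW \<rho> (level0 l0) \<and>
    L_series p \<rho> = YW (np_act p (level0 l0) (T (-2)) (np_vac p (level0 l0))) \<and>
    (\<forall>i\<in>{1..p-1}.
       I_series p \<rho> i = YW (np_act p (level0 l0) (N i (-1)) (np_vac p (level0 l0))))"
proof -
  interpret twisted_np_module p "level0 l0" \<xi> Y scaleW YW
    using assms by unfold_locales (simp_all add: primitive_root_def)
  show ?thesis
    using gap_module_lin_ext restricted_lin_ext has_level_lin_ext L_series_lin_ext I_series_lin_ext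
    by blast
qed

end
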